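(* Let $(n_j)_{j\ge1}$ be a strictly increasing unbounded sequence of positive real numbers, let $a_j>0$ for $j\ge1$, and suppose that $A(x)=\sum_{n_j\le x}a_j$ satisfies $A(x)=\rho x+O(x^\beta)$ as $x\to\infty$ for some $\rho>0$ and $0\le\beta<1$. Let $f(s)=\sum_{j=1}^\infty a_jn_j^{-s}$ for $\operatorname{Re}s>1$, extended by analytic continuation to $\operatorname{Re}s>\beta$, $s\ne1$. Given $\sigma>\beta$ and $T>0$, let $N(\sigma,T)$ be the number of zeros $s'=\sigma'+it'$ of $f(s)$ satisfying $\sigma'\ge\sigma$ and $|t'|\le T$. Then for every $\sigma>\frac{1+\beta}{2}$, $$N(\sigma,T)\ll_\sigma T,$$ i.e. there is a constant $C$, depending on $\sigma$ (and on $f$), such that $N(\sigma,T)\le CT$ for all sufficiently large $T$.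
   Context: Under the hypothesis on $A$, the series $f(s)$ converges absolutely for $\operatorname{Re}s>1$, and $f(s)-\rho/(s-1)$ has an analytic continuation to the half-plane $\operatorname{Re}s>\beta$; $f$ denotes the continued function. *)

theory Defs
  imports "HOL-Complex_Analysis.Complex_Analysis" "HOL-Library.Landau_Symbols"
begin

text \<open>
  Sequences \<open>(n_j)\<close>, \<open>(a_j)\<close> are indexed from \<open>0\<close> instead of from \<open>1\<close>.
\<close>

definition summatory :: "(nat \<Rightarrow> real) \<Rightarrow> (nat \<Rightarrow> real) \<Rightarrow> real \<Rightarrow> real" where
  "summatory a n x = (\<Sum>j | n j \<le> x. a j)"

definition dirichlet_sum :: "(nat \<Rightarrow> real) \<Rightarrow> (nat \<Rightarrow> real) \<Rightarrow> complex \<Rightarrow> complex" where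
  "dirichlet_sum a n s = (\<Sum>j. of_real (a j) * of_real (n j) powr (- s))"

text \<open>
  The analytic continuation to \<open>Re s > \<beta>\<close>, \<open>s \<noteq> 1\<close>. On this connected open set it is unique (for
  \<open>\<beta> < 1\<close>), so the choice operator leaves only the values outside it, in particular the value
  at \<open>1\<close>, undetermined.
\<close>

definition dirichlet_cont ::
    "(nat \<Rightarrow> real) \<Rightarrow> (nat \<Rightarrow> real) \<Rightarrow> real \<Rightarrow> complex \<Rightarrow> complex" where
  "dirichlet_cont a n \<beta> = (SOME F. F holomorphic_on ({s. Re s > \<beta>} - {1}) \<and>
     (\<forall>s. Re s > 1 \<longrightarrow> F s = dirichlet_sum a n s))"

text \<open>
  The point \<open>1\<close> is excluded because \<open>f\<close> has a pole there and its HOL value is meaningless.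
\<close>

definition zeros_in :: "(complex \<Rightarrow> complex) \<Rightarrow> real \<Rightarrow> real \<Rightarrow> complex set" where
  "zeros_in f \<sigma> T = {s. s \<noteq> 1 \<and> f s = 0 \<and> Re s \<ge> \<sigma> \<and> \<bar>Im s\<bar> \<le> T}"

text \<open>
  Zeros are counted with multiplicity. The sum is \<open>0\<close> by convention if there are infinitely many
  zeros, so statements about it should be accompanied by finiteness of \<^const>\<open>zeros_in\<close>.
\<close>

definition zero_count :: "(complex \<Rightarrow> complex) \<Rightarrow> real \<Rightarrow> real \<Rightarrow> nat" where
  "zero_count f \<sigma> T = (\<Sum>s \<in> zeros_in f \<sigma> T. nat (zorder f s))"

end

theory Submission imports Defs "HOL-Real_Asymp.Real_Asymp" begin

text \<open>
  Write \<open>n\<^sub>j = n\<^sub>0 exp \<lambda>\<^sub>j\<close> and let \<open>E(u)\<close> be the error term of the summatory function at \<open>n\<^sub>0 exp u\<close>. Then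
  \<open>n\<^sub>0\<^sup>s f(s) = s L(s) + \<rho> n\<^sub>0 s / (s - 1)\<close>, where \<open>L\<close> is the Laplace transform of \<open>E\<close>, which gives the
  continuation to \<open>Re s > \<beta>\<close>. The heart of the proof is the mean square bound \<open>O(T)\<close> for \<open>s L(s)\<close> at points of
  height at most \<open>T\<close>, one close to each integer height. The transform of \<open>E(u + h) - E(u)\<close> is
  \<open>(exp (s h) - 1) L(s)\<close>, so with \<open>h\<close> of order \<open>1/T\<close> a large sieve inequality reduces the bound to
  \<open>\<integral>\<bar>E(u + h) - E(u)\<bar>\<^sup>2 exp (-2 \<sigma> u) du = O(h)\<close>. One of the two factors \<open>\<bar>E(u + h) - E(u)\<bar>\<close> is at most
  \<open>O(exp (\<beta> u))\<close>, the other one at most the increment of a monotone function of size \<open>O(exp u)\<close>, and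
  \<open>2 \<sigma> > 1 + \<beta>\<close> makes the integral converge. Finally Jensen's inequality bounds the number of zeros in
  a disc by the maximum of \<open>\<bar>f\<bar>\<close> on a slightly larger circle.
\<close>

subsection \<open>Laplace transforms\<close>

text \<open>The pointwise estimate \<open>s * L s = O(\<bar>s\<bar>)\<close> allows
  \<open>O(log T)\<close> zeros per disc of fixed radius, hence only \<open>O(T log T)\<close> zeros
  in all. The logarithm disappears once \<open>f\<close> is bounded on average over the discs, which
  is why a discrete mean square is wanted. Jensen's inequality is accordingly used in a weak form,
  linear in the maximum of \<open>\<bar>f\<bar>\<close>; a linear term is at most a square plus a
  constant, so the sum over the discs is controlled by the mean square. Applied to \<open>E\<close>
  directly, the large sieve bounds the sum of \<open>\<bar>L\<bar>^2\<close> by a constant, and the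
  factor \<open>s\<close> then costs \<open>T^2\<close>. Differencing saves one power of
  \<open>T\<close>: for \<open>h\<close> a small multiple of \<open>1 / T\<close> the factor
  \<open>exp (s h) - 1\<close> is comparable with \<open>s h\<close>, so the sum of
  \<open>\<bar>s L\<bar>^2\<close> is at most \<open>O(1 / h^2)\<close> times the difference
  integral \<open>O(h)\<close>.\<close>

lemma integrable_exp_atLeast:
  fixes k c :: real
  assumes "k > 0"
  shows "integrable lborel (\<lambda>u. exp (- k * u) * indicator {c..} u)"
    and "(\<integral>u. exp (- k * u) * indicator {c..} u \<partial>lborel) = exp (- k * c) / k"
proof -
  have lim: "((\<lambda>u. - exp (- k * u) / k) \<longlongrightarrow> 0) at_top"
    using assms by real_asymp
  have "(\<integral>\<^sup>+x. ennreal (exp (- k * x)) * indicator {c..} x \<partial>lborel) = 0 - (- exp (- k * c) / k)"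
    using assms by (intro nn_integral_FTC_atLeast[OF _ _ _ lim]) (auto intro!: derivative_eq_intros)
  then have *: "(\<integral>\<^sup>+x. ennreal (exp (- k * x) * indicator {c..} x) \<partial>lborel) = ennreal (exp (- k * c) / k)"
    by (simp add: ennreal_mult' ennreal_indicator)
  have "has_bochner_integral lborel (\<lambda>u. exp (- k * u) * indicator {c..} u) (exp (- k * c) / k)"
    by (rule has_bochner_integral_nn_integral[OF _ _ _ *]) (use assms in auto)
  then show "integrable lborel (\<lambda>u. exp (- k * u) * indicator {c..} u)"
    and "(\<integral>u. exp (- k * u) * indicator {c..} u \<partial>lborel) = exp (- k * c) / k"
    by (auto simp: has_bochner_integral_iff)
qed

text \<open>The integral runs over the whole line and the support is a property of
  \<open>\<phi>\<close>. A translate that starts left of \<open>0\<close> then has a transform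
  without any boundary term.\<close>

definition laplace :: "(real \<Rightarrow> real) \<Rightarrow> complex \<Rightarrow> complex" where
  "laplace \<phi> s = (\<integral>u. of_real (\<phi> u) * exp (- (s * of_real u)) \<partial>lborel)"

text \<open>Growth and support in one inequality: \<open>b\<close> is the left end of the support,
  \<open>0\<close> for the error term and \<open>-1\<close> for its differences with step
  \<open>h \<le> 1\<close>.\<close>

definition exp_bdd :: "real \<Rightarrow> real \<Rightarrow> real \<Rightarrow> (real \<Rightarrow> real) \<Rightarrow> bool" where
  "exp_bdd b K \<beta> \<phi> \<longleftrightarrow> \<phi> \<in> borel_measurable borel \<and>
     (\<forall>u. \<bar>\<phi> u\<bar> \<le> K * exp (\<beta> * u) * indicator {b..} u)"

lemma exp_bddD:
  assumes "exp_bdd b K \<beta> \<phi>"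
  shows "\<phi> \<in> borel_measurable borel" "\<bar>\<phi> u\<bar> \<le> K * exp (\<beta> * u) * indicator {b..} u"
  using assms by (auto simp: exp_bdd_def)

lemma norm_laplace_integrand_le:
  assumes "exp_bdd b K \<beta> \<phi>"
  shows "norm (of_real (\<phi> u) * exp (- (s * of_real u)) :: complex)
           \<le> K * (exp (- (Re s - \<beta>) * u) * indicator {b..} u)"
proof -
  have "norm (of_real (\<phi> u) * exp (- (s * of_real u)) :: complex) = \<bar>\<phi> u\<bar> * exp (- Re s * u)"
    by (simp add: norm_mult norm_exp_eq_Re)
  also have "\<dots> \<le> (K * exp (\<beta> * u) * indicator {b..} u) * exp (- Re s * u)"
    using exp_bddD(2)[OF assms] by (intro mult_right_mono) auto
  also have "\<dots> = K * (exp (- (Re s - \<beta>) * u) * indicator {b..} u)"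
    by (simp add: mult_exp_exp algebra_simps)
  finally show ?thesis .
qed

lemma integrable_laplace:
  assumes "exp_bdd b K \<beta> \<phi>" and "Re s > \<beta>"
  shows "integrable lborel (\<lambda>u. of_real (\<phi> u) * exp (- (s * of_real u)) :: complex)"
proof (rule Bochner_Integration.integrable_bound)
  show "integrable lborel (\<lambda>u. K * (exp (- (Re s - \<beta>) * u) * indicator {b..} u))"
    by (intro integrable_mult_right integrable_exp_atLeast) (use assms in auto)
  show "(\<lambda>u. of_real (\<phi> u) * exp (- (s * of_real u)) :: complex) \<in> borel_measurable lborel"
    using exp_bddD(1)[OF assms(1)] by measurable
  show "AE u in lborel. norm (of_real (\<phi> u) * exp (- (s * of_real u)) :: complex)
           \<le> norm (K * (exp (- (Re s - \<beta>) * u) * indicator {b..} u))"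
    using norm_laplace_integrand_le[OF assms(1)]
    by (intro AE_I2) (smt (verit, best) real_norm_def)
qed

lemma norm_exp_minus_1_minus_le:
  fixes z :: complex
  shows "norm (exp z - 1 - z) \<le> norm z ^ 2 * exp (norm z)"
proof -
  have "norm (exp z - (\<Sum>i\<le>1. z ^ i / fact i)) \<le> exp (norm z) * norm z ^ Suc 1 / fact 1"
    by (rule Taylor_exp_field)
  then show ?thesis by (simp add: algebra_simps power2_eq_square)
qed

text \<open>Differentiation under the integral sign by a direct estimate: the error of the
  difference quotient is an integral of \<open>\<phi>\<close> against the Taylor remainder of the
  exponential beyond its linear term, and this is \<open>O(\<bar>h\<bar>)\<close> after division by
  \<open>h\<close>.\<close>

lemma laplace_has_field_derivative:
  assumes bd: "exp_bdd 0 K \<beta> \<phi>" and s: "Re s > \<beta>"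
  shows "(laplace \<phi> has_field_derivative
           (\<integral>u. - of_real u * of_real (\<phi> u) * exp (- (s * of_real u)) \<partial>lborel)) (at s)"
proof -
  \<comment> \<open>The gap \<open>Re s - \<beta>\<close> is spent in thirds: one pays for
    \<open>exp (\<bar>h\<bar> * u)\<close> in the remainder, one for the factor \<open>u^2\<close>,
    and one keeps the majorant integrable.\<close>
  define \<delta> where "\<delta> = (Re s - \<beta>) / 3"
  have \<delta>: "\<delta> > 0" and Re_s: "Re s = \<beta> + 3 * \<delta>"
    using s by (auto simp: \<delta>_def field_simps)
  have [measurable]: "\<phi> \<in> borel_measurable borel" by (rule exp_bddD(1)[OF bd])
  define e :: "real \<Rightarrow> complex" where "e = (\<lambda>u. of_real (\<phi> u) * exp (- (s * of_real u)))"
  define D :: complex where "D = (\<integral>u. - of_real u * e u \<partial>lborel)"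
  have [measurable]: "e \<in> borel_measurable borel" unfolding e_def by measurable
  have e_le: "norm (e u) \<le> K * (exp (- (3 * \<delta>) * u) * indicator {0..} u)" for u
    using norm_laplace_integrand_le[OF bd, of u s] by (simp add: e_def Re_s)
  have "0 \<le> norm (e 0)" by simp
  with e_le[of 0] have K: "K \<ge> 0" by (smt (verit) exp_zero indicator_simps(1) atLeast_iff mult_cancel_left2 mult_zero_right)
  have u_le: "u * exp (- (3 * \<delta>) * u) \<le> 1 / \<delta> * exp (- \<delta> * u)" if "u \<ge> 0" for u
  proof -
    have "\<delta> * u \<le> exp (\<delta> * u)" using exp_ge_add_one_self[of "\<delta> * u"] by linarith
    then have "u \<le> 1 / \<delta> * exp (\<delta> * u)" using \<delta> by (simp add: field_simps)
    then have "u * exp (- (3 * \<delta>) * u) \<le> (1 / \<delta> * exp (\<delta> * u)) * exp (- (3 * \<delta>) * u)"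
      by (intro mult_right_mono) auto
    also have "\<dots> = 1 / \<delta> * exp (- (2 * \<delta>) * u)" by (simp add: mult_exp_exp algebra_simps)
    also have "\<dots> \<le> 1 / \<delta> * exp (- \<delta> * u)" using \<delta> that by (intro mult_left_mono) auto
    finally show ?thesis .
  qed
  have u2_le: "u\<^sup>2 * exp (- (2 * \<delta>) * u) \<le> 2 / \<delta>\<^sup>2 * exp (- \<delta> * u)" if "u \<ge> 0" for u
  proof -
    have "(\<delta> * u)\<^sup>2 / 2 \<le> exp (\<delta> * u)"
    proof -
      have "0 \<le> \<delta> * u" using that \<delta> by simp
      then show ?thesis using exp_lower_Taylor_quadratic[of "\<delta> * u"] by linarith
    qed
    then have "u\<^sup>2 \<le> 2 / \<delta>\<^sup>2 * exp (\<delta> * u)" using \<delta> by (simp add: field_simps power2_eq_square)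
    then have "u\<^sup>2 * exp (- (2 * \<delta>) * u) \<le> (2 / \<delta>\<^sup>2 * exp (\<delta> * u)) * exp (- (2 * \<delta>) * u)"
      by (intro mult_right_mono) auto
    also have "\<dots> = 2 / \<delta>\<^sup>2 * exp (- \<delta> * u)" by (simp add: mult_exp_exp algebra_simps)
    finally show ?thesis .
  qed
  have exp_int: "integrable lborel (\<lambda>u. c * (exp (- \<delta> * u) * indicator {0..} u))" for c
    by (intro integrable_mult_right integrable_exp_atLeast \<delta>)
  have int_e: "integrable lborel e"
    unfolding e_def by (rule integrable_laplace[OF bd s])
  have int_ue: "integrable lborel (\<lambda>u. - of_real u * e u)"
  proof (rule Bochner_Integration.integrable_bound[OF exp_int[of "K / \<delta>"]])
    show "AE u in lborel. norm (- of_real u * e u) \<le> norm (K / \<delta> * (exp (- \<delta> * u) * indicator {0..} u))"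
    proof (rule AE_I2)
      fix u :: real
      show "norm (- of_real u * e u) \<le> norm (K / \<delta> * (exp (- \<delta> * u) * indicator {0..} u))"
      proof (cases "u \<ge> 0")
        case True
        have "norm (- of_real u * e u) \<le> u * (K * exp (- (3 * \<delta>) * u))"
          using mult_left_mono[OF e_le[of u] True] True by (simp add: norm_mult)
        also have "\<dots> \<le> K * (1 / \<delta> * exp (- \<delta> * u))"
          using mult_left_mono[OF u_le[OF True] K] by (simp add: algebra_simps)
        finally show ?thesis using True K \<delta> by simp
      next
        case False
        then show ?thesis using e_le[of u] by simp
      qed
    qed
  qed measurable
  define C where "C = K * (2 / \<delta>\<^sup>2) * (1 / \<delta>)"
  have quot: "norm ((laplace \<phi> (s + h) - laplace \<phi> s) / h - D) \<le> norm h * C"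
    if h: "norm h < \<delta>" "h \<noteq> 0" for h
  proof -
    have "Re (s + h) > \<beta>" using abs_Re_le_cmod[of h] h Re_s \<delta> by auto
    then have int_h: "integrable lborel (\<lambda>u. of_real (\<phi> u) * exp (- ((s + h) * of_real u)) :: complex)"
      by (rule integrable_laplace[OF bd])
    have split: "exp (- ((s + h) * of_real u)) = exp (- (s * of_real u)) * exp (- (h * of_real u))" for u
      by (simp add: algebra_simps flip: exp_add)
    have "laplace \<phi> (s + h) - laplace \<phi> s - h * D
        = (\<integral>u. of_real (\<phi> u) * exp (- ((s + h) * of_real u)) - e u - h * (- of_real u * e u) \<partial>lborel)"
      unfolding laplace_def D_def using int_h int_e int_ue by (simp add: e_def)
    also have "\<dots> = (\<integral>u. e u * (exp (- (h * of_real u)) - 1 - (- (h * of_real u))) \<partial>lborel)"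
      by (intro Bochner_Integration.integral_cong refl) (simp only: e_def split, simp add: ring_distribs mult.assoc)
    also have "norm \<dots> \<le> (\<integral>u. norm h ^ 2 * (K * (2 / \<delta>\<^sup>2)) * (exp (- \<delta> * u) * indicator {0..} u) \<partial>lborel)"
    proof (rule Bochner_Integration.integral_norm_bound_integral)
      have "integrable lborel (\<lambda>u. of_real (\<phi> u) * exp (- ((s + h) * of_real u)) - e u - h * (- of_real u * e u))"
        using int_h int_e int_ue by (intro Bochner_Integration.integrable_diff integrable_mult_right)
      also have "(\<lambda>u. of_real (\<phi> u) * exp (- ((s + h) * of_real u)) - e u - h * (- of_real u * e u))
               = (\<lambda>u. e u * (exp (- (h * of_real u)) - 1 - (- (h * of_real u))))"
        by (intro ext) (simp only: e_def split, simp add: ring_distribs mult.assoc)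
      finally show "integrable lborel (\<lambda>u. e u * (exp (- (h * of_real u)) - 1 - (- (h * of_real u))))" .
      fix u :: real
      show "norm (e u * (exp (- (h * of_real u)) - 1 - (- (h * of_real u))))
          \<le> norm h ^ 2 * (K * (2 / \<delta>\<^sup>2)) * (exp (- \<delta> * u) * indicator {0..} u)"
      proof (cases "u \<ge> 0")
        case True
        have "norm (exp (- (h * of_real u)) - 1 - (- (h * of_real u))) \<le> norm h ^ 2 * u\<^sup>2 * exp (\<delta> * u)"
        proof -
          have "norm (exp (- (h * of_real u)) - 1 - (- (h * of_real u)))
              \<le> norm (- (h * of_real u)) ^ 2 * exp (norm (- (h * of_real u)))"
            by (rule norm_exp_minus_1_minus_le)
          also have "\<dots> = norm h ^ 2 * u\<^sup>2 * exp (norm h * u)"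
            using True by (simp add: norm_mult power_mult_distrib)
          also have "\<dots> \<le> norm h ^ 2 * u\<^sup>2 * exp (\<delta> * u)"
            using True h by (intro mult_left_mono) (auto intro!: mult_right_mono)
          finally show ?thesis .
        qed
        moreover have "norm (e u) \<le> K * exp (- (3 * \<delta>) * u)" using e_le[of u] True by simp
        ultimately have "norm (e u * (exp (- (h * of_real u)) - 1 - (- (h * of_real u))))
          \<le> (K * exp (- (3 * \<delta>) * u)) * (norm h ^ 2 * u\<^sup>2 * exp (\<delta> * u))"
          unfolding norm_mult using K by (intro mult_mono) auto
        also have "\<dots> = norm h ^ 2 * (K * (u\<^sup>2 * exp (- (2 * \<delta>) * u)))"
          by (simp add: mult_exp_exp algebra_simps)
        also have "\<dots> \<le> norm h ^ 2 * (K * (2 / \<delta>\<^sup>2 * exp (- \<delta> * u)))"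
          using u2_le[OF True] K by (intro mult_left_mono) auto
        finally show ?thesis using True by simp
      next
        case False
        then show ?thesis using e_le[of u] by simp
      qed
    qed (rule exp_int)
    also have "\<dots> = norm h ^ 2 * C"
      using integrable_exp_atLeast(2)[OF \<delta>, of 0] by (simp add: C_def)
    finally have *: "norm (laplace \<phi> (s + h) - laplace \<phi> s - h * D) \<le> norm h ^ 2 * C" .
    have "(laplace \<phi> (s + h) - laplace \<phi> s) / h - D = (laplace \<phi> (s + h) - laplace \<phi> s - h * D) / h"
      using h by (simp add: field_simps)
    then show ?thesis using * h by (simp add: norm_divide field_simps power2_eq_square)
  qed
  have "((\<lambda>h. (laplace \<phi> (s + h) - laplace \<phi> s) / h - D) \<longlongrightarrow> 0) (at 0)"
  proof (rule Lim_null_comparison)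
    show "\<forall>\<^sub>F h in at 0. norm ((laplace \<phi> (s + h) - laplace \<phi> s) / h - D) \<le> norm h * C"
      using quot \<delta> by (auto simp: eventually_at intro!: exI[of _ \<delta>])
    show "((\<lambda>h. norm h * C) \<longlongrightarrow> 0) (at (0 :: complex))"
      by (rule tendsto_eq_intros | simp)+
  qed
  then have "(\<lambda>h. (laplace \<phi> (s + h) - laplace \<phi> s) / h) \<midarrow>0\<rightarrow> D"
    by (simp add: Lim_null[symmetric])
  then show ?thesis
    by (simp add: DERIV_def D_def e_def mult.assoc)
qed

lemma laplace_holomorphic:
  assumes "exp_bdd 0 K \<beta> \<phi>"
  shows "laplace \<phi> holomorphic_on {s. Re s > \<beta>}"
  using laplace_has_field_derivative[OF assms]
  by (auto simp: holomorphic_on_def field_differentiable_def intro: has_field_derivative_at_within)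

text \<open>The antiderivative is evaluated on \<open>[c, y]\<close> and \<open>y\<close> tends to
  infinity. Later closed forms reduce to this one: the jumps of the summatory function are such
  indicators, and an exponential factor only translates \<open>s\<close>.\<close>

lemma laplace_indicator:
  assumes "Re s > 0"
  shows "laplace (indicator {c..}) s = exp (- (s * of_real c)) / s"
proof -
  have int: "integrable lborel (\<lambda>u. of_real (indicator {c..} u) * exp (- (s * of_real u)) :: complex)"
    by (rule integrable_laplace[of c 1 0]) (use assms in \<open>auto simp: exp_bdd_def\<close>)
  have 1: "((\<lambda>y. \<integral>u. indicator {..y} u *\<^sub>R (of_real (indicator {c..} u) * exp (- (s * of_real u))) \<partial>lborel)
          \<longlongrightarrow> laplace (indicator {c..}) s) at_top"
    unfolding laplace_def by (rule tendsto_integral_at_top[OF _ int]) simp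
  have eq: "(\<integral>u. indicator {..y} u *\<^sub>R (of_real (indicator {c..} u) * exp (- (s * of_real u))) \<partial>lborel)
      = - exp (- (s * of_real y)) / s - (- exp (- (s * of_real c)) / s)" if "y \<ge> c" for y
  proof -
    have "(\<integral>u. indicator {..y} u *\<^sub>R (of_real (indicator {c..} u) * exp (- (s * of_real u))) \<partial>lborel)
        = (\<integral>u. indicator {c..y} u *\<^sub>R exp (- (s * of_real u)) \<partial>lborel)"
      by (intro Bochner_Integration.integral_cong refl) (auto simp: indicator_def)
    also have "\<dots> = - exp (- (s * of_real y)) / s - (- exp (- (s * of_real c)) / s)"
    proof (intro integral_FTC_atLeastAtMost that)
      fix x :: real
      have "((\<lambda>z. - exp (- (s * z)) / s) has_field_derivative exp (- (s * of_real x))) (at (of_real x))"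
        using assms by (auto intro!: derivative_eq_intros)
      then have "((\<lambda>x. - exp (- (s * of_real x)) / s) has_vector_derivative exp (- (s * of_real x))) (at x)"
        by (rule has_vector_derivative_real_field)
      then show "((\<lambda>x. - exp (- (s * of_real x)) / s) has_vector_derivative exp (- (s * of_real x)))
          (at x within {c..y})"
        by (rule has_vector_derivative_at_within)
    qed (auto intro!: continuous_intros)
    finally show ?thesis .
  qed
  have n: "((\<lambda>y. exp (- (s * of_real y))) \<longlongrightarrow> 0) at_top"
  proof (rule Lim_null_comparison)
    show "\<forall>\<^sub>F y in at_top. norm (exp (- (s * of_real y))) \<le> exp (- (Re s * y))"
      by (simp add: norm_exp_eq_Re)
    show "((\<lambda>y. exp (- (Re s * y))) \<longlongrightarrow> 0) at_top"
      using assms by real_asymp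
  qed
  have "((\<lambda>y. - exp (- (s * of_real y)) / s - (- exp (- (s * of_real c)) / s))
          \<longlongrightarrow> - 0 / s - (- exp (- (s * of_real c)) / s)) at_top"
    by (intro tendsto_intros n) (use assms in auto)
  then have 2: "((\<lambda>y. \<integral>u. indicator {..y} u *\<^sub>R (of_real (indicator {c..} u) * exp (- (s * of_real u))) \<partial>lborel)
          \<longlongrightarrow> exp (- (s * of_real c)) / s) at_top"
    by (rule Lim_transform_eventually[rotated, THEN tendsto_eq_rhs, rotated])
       (use eq in \<open>auto intro!: eventually_at_top_linorderI[of c] simp: eq[symmetric]\<close>)
  show ?thesis by (rule tendsto_unique[OF _ 1 2]) simp
qed

subsection \<open>A large sieve inequality for Laplace transforms\<close>

text \<open>This bounds the row sums of the large sieve kernel uniformly in the row \<open>m\<close>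
  and in the finite index set. The integers up to \<open>m\<close> and those beyond it are each
  mapped injectively to the naturals by \<open>\<bar>m - k\<bar>\<close>, so two copies of one
  convergent series suffice.\<close>

lemma sum_inverse_1_plus_square_bounded:
  obtains S :: real where "S > 0"
    "\<And>M (m :: int). finite M \<Longrightarrow> (\<Sum>k\<in>M. 1 / (1 + (of_int (m - k))\<^sup>2)) \<le> S"
proof -
  define g where "g = (\<lambda>j :: nat. 1 / (1 + (real j)\<^sup>2))"
  have "summable (\<lambda>j. 1 / (real j)\<^sup>2)"
    using inverse_power_summable[of 2, where ?'a = real] by (simp add: field_simps)
  then have "summable (\<lambda>j. 1 / (real (Suc j))\<^sup>2)"
    by (subst summable_Suc_iff)
  then have "summable (\<lambda>j. g (Suc j))"
  proof (rule summable_comparison_test'[of _ 0])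
    fix j
    have "1 / (1 + (real (Suc j))\<^sup>2) \<le> 1 / (real (Suc j))\<^sup>2" by (rule frac_le) auto
    then show "norm (g (Suc j)) \<le> 1 / (real (Suc j))\<^sup>2" by (simp add: g_def)
  qed
  then have g: "summable g" by (subst (asm) summable_Suc_iff)
  have g_nonneg: "g j \<ge> 0" for j by (simp add: g_def)
  have le: "(\<Sum>k\<in>N. g (f k)) \<le> suminf g" if "finite N" "inj_on f N" for N :: "int set" and f
  proof -
    have "(\<Sum>k\<in>N. g (f k)) = sum g (f ` N)" using that by (simp add: sum.reindex)
    also have "\<dots> \<le> suminf g" by (rule sum_le_suminf[OF g]) (use that g_nonneg in auto)
    finally show ?thesis .
  qed
  show ?thesis
  proof (rule that[of "2 * suminf g + 1"])
    show "2 * suminf g + 1 > 0" using suminf_nonneg[OF g g_nonneg] by linarith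
    fix M :: "int set" and m :: int
    assume M: "finite M"
    have "(\<Sum>k\<in>M. 1 / (1 + (of_int (m - k))\<^sup>2))
        = (\<Sum>k\<in>M \<inter> {k. k \<le> m}. 1 / (1 + (of_int (m - k))\<^sup>2)) + (\<Sum>k\<in>M - {k. k \<le> m}. 1 / (1 + (of_int (m - k))\<^sup>2))"
      (is "_ = ?a + ?b")
      by (rule sum.Int_Diff[OF M])
    also have "?a = (\<Sum>k\<in>M \<inter> {k. k \<le> m}. g (nat (m - k)))"
      by (intro sum.cong) (auto simp: g_def)
    also have "\<dots> \<le> suminf g" by (rule le) (use M in \<open>auto simp: inj_on_def\<close>)
    also have "?b = (\<Sum>k\<in>M - {k. k \<le> m}. g (nat (k - m)))"
      by (intro sum.cong) (auto simp: g_def power2_commute)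
    also have "\<dots> \<le> suminf g" by (rule le) (use M in \<open>auto simp: inj_on_def\<close>)
    finally show "(\<Sum>k\<in>M. 1 / (1 + (of_int (m - k))\<^sup>2)) \<le> 2 * suminf g + 1" by simp
  qed
qed

text \<open>
  The weight \<open>1 - exp (-v)\<close> on \<open>v \<ge> 0\<close> is continuous at \<open>0\<close>, so its transform decays quadratically. The
  sharp cutoff has transform \<open>1 / Z\<close>, which would cost a factor \<open>log T\<close> in the large sieve.
\<close>

lemma laplace_one_minus_exp:
  fixes Z :: complex
  assumes "Re Z > 0"
  defines "f \<equiv> (\<lambda>v. of_real ((1 - exp (- v)) * indicator {0..} v) * exp (- (Z * of_real v)))"
  shows "has_bochner_integral lborel f (1 / (Z * (Z + 1)))"
proof -
  have bd: "exp_bdd 0 1 0 (indicator {0..})" by (auto simp: exp_bdd_def)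
  have "has_bochner_integral lborel
      (\<lambda>v. of_real (indicator {0..} v) * exp (- (Z * of_real v)) - of_real (indicator {0..} v) * exp (- ((Z + 1) * of_real v)))
      (laplace (indicator {0..}) Z - laplace (indicator {0..}) (Z + 1))"
    unfolding laplace_def
    by (intro has_bochner_integral_diff has_bochner_integral_integrable integrable_laplace[OF bd])
       (use assms in auto)
  also have "laplace (indicator {0..}) Z - laplace (indicator {0..}) (Z + 1) = 1 / (Z * (Z + 1))"
  proof -
    have "Z \<noteq> 0" "Z + 1 \<noteq> 0" using assms by (auto simp: complex_eq_iff)
    then show ?thesis using assms by (simp add: laplace_indicator field_simps)
  qed
  also have "(\<lambda>v. of_real (indicator {0..} v) * exp (- (Z * of_real v)) - of_real (indicator {0..} v) * exp (- ((Z + 1) * of_real v))) = f"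
  proof
    fix v :: real
    have "exp (- ((Z + 1) * of_real v)) = of_real (exp (- v)) * exp (- (Z * of_real v))"
      by (simp add: algebra_simps flip: exp_of_real exp_add)
    then show "of_real (indicator {0..} v) * exp (- (Z * of_real v))
        - of_real (indicator {0..} v) * exp (- ((Z + 1) * of_real v)) = f v"
      by (auto simp: f_def indicator_def ring_distribs)
  qed
  finally show ?thesis .
qed

text \<open>Expanding the square gives a Hermitian form whose matrix entries are values of the
  transform of the weight at \<open>z m + cnj (z k)\<close>. Schur's test finishes: the products are
  split by the arithmetic-geometric mean inequality, and the symmetry of the majorant leaves only
  its row sums, at most \<open>\<kappa> * S\<close>.\<close>

lemma weighted_exp_sum_norm_square_integral:
  fixes b z :: "int \<Rightarrow> complex"
  assumes M: "finite M" and S: "\<And>m. m \<in> M \<Longrightarrow> (\<Sum>k\<in>M. 1 / (1 + (of_int (m - k))\<^sup>2)) \<le> S"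
    and re: "\<And>m. m \<in> M \<Longrightarrow> Re (z m) > 0"
    and ker: "\<And>m k. m \<in> M \<Longrightarrow> k \<in> M \<Longrightarrow>
      norm (1 / ((z m + cnj (z k)) * (z m + cnj (z k) + 1))) \<le> \<kappa> * (1 / (1 + (of_int (m - k))\<^sup>2))"
    and \<kappa>: "\<kappa> \<ge> 0"
  defines "f \<equiv> (\<lambda>v. (1 - exp (- v)) * indicator {0..} v * (norm (\<Sum>m\<in>M. b m * exp (- (z m * of_real v))))\<^sup>2)"
  shows "integrable lborel f" and "integral\<^sup>L lborel f \<le> \<kappa> * S * (\<Sum>m\<in>M. (norm (b m))\<^sup>2)"
proof -
  define Z where "Z = (\<lambda>m k. z m + cnj (z k))"
  define I where "I = (\<Sum>m\<in>M. \<Sum>k\<in>M. (b m * cnj (b k)) * (1 / (Z m k * (Z m k + 1))))"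
  have "has_bochner_integral lborel (\<lambda>v. \<Sum>m\<in>M. \<Sum>k\<in>M. (b m * cnj (b k)) *
      (of_real ((1 - exp (- v)) * indicator {0..} v) * exp (- (Z m k * of_real v)))) I"
    unfolding I_def
    by (intro has_bochner_integral_sum has_bochner_integral_mult_right laplace_one_minus_exp)
       (use re in \<open>auto simp: Z_def intro!: add_pos_pos\<close>)
  also have "(\<lambda>v. \<Sum>m\<in>M. \<Sum>k\<in>M. (b m * cnj (b k)) *
      (of_real ((1 - exp (- v)) * indicator {0..} v) * exp (- (Z m k * of_real v)))) = (\<lambda>v. of_real (f v))"
  proof
    fix v :: real
    have "of_real (f v) = of_real ((1 - exp (- v)) * indicator {0..} v) *
       ((\<Sum>m\<in>M. b m * exp (- (z m * of_real v))) * (\<Sum>k\<in>M. cnj (b k * exp (- (z k * of_real v)))))"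
      unfolding f_def of_real_mult[of _ "(norm _)\<^sup>2"] complex_norm_square cnj_sum[symmetric] ..
    also have "\<dots> = (\<Sum>m\<in>M. \<Sum>k\<in>M. of_real ((1 - exp (- v)) * indicator {0..} v) *
        ((b m * exp (- (z m * of_real v))) * cnj (b k * exp (- (z k * of_real v)))))"
      by (subst sum_product) (simp only: sum_distrib_left)
    also have "\<dots> = (\<Sum>m\<in>M. \<Sum>k\<in>M. (b m * cnj (b k)) *
        (of_real ((1 - exp (- v)) * indicator {0..} v) * exp (- (Z m k * of_real v))))"
      by (intro sum.cong refl)
         (simp add: Z_def exp_cnj algebra_simps flip: exp_add)
    finally show "(\<Sum>m\<in>M. \<Sum>k\<in>M. (b m * cnj (b k)) *
        (of_real ((1 - exp (- v)) * indicator {0..} v) * exp (- (Z m k * of_real v)))) = of_real (f v)" ..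
  qed
  finally have *: "has_bochner_integral lborel (\<lambda>v. complex_of_real (f v)) I" .
  have "has_bochner_integral lborel (\<lambda>v. Re (complex_of_real (f v))) (Re I)"
    by (rule has_bochner_integral_Re[OF *])
  then have hf: "has_bochner_integral lborel f (Re I)" by simp
  then show "integrable lborel f" by (simp add: has_bochner_integral_iff)
  have "Re I \<le> norm I" by (rule complex_Re_le_cmod)
  also have "\<dots> \<le> (\<Sum>m\<in>M. \<Sum>k\<in>M. norm ((b m * cnj (b k)) * (1 / (Z m k * (Z m k + 1)))))"
    unfolding I_def by (intro order_trans[OF norm_sum] sum_mono order_refl)
  also have "\<dots> \<le> (\<Sum>m\<in>M. \<Sum>k\<in>M. (((norm (b m))\<^sup>2 + (norm (b k))\<^sup>2) / 2) * (\<kappa> * (1 / (1 + (of_int (m - k))\<^sup>2))))"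
  proof (intro sum_mono)
    fix m k assume mk: "m \<in> M" "k \<in> M"
    have "norm ((b m * cnj (b k)) * (1 / (Z m k * (Z m k + 1))))
        = (norm (b m) * norm (b k)) * norm (1 / (Z m k * (Z m k + 1)))"
      by (simp add: norm_mult norm_divide)
    also have "\<dots> \<le> (((norm (b m))\<^sup>2 + (norm (b k))\<^sup>2) / 2) * (\<kappa> * (1 / (1 + (of_int (m - k))\<^sup>2)))"
      using ker[OF mk] sum_squares_bound[of "norm (b m)" "norm (b k)"] unfolding Z_def
      by (intro mult_mono) auto
    finally show "norm ((b m * cnj (b k)) * (1 / (Z m k * (Z m k + 1))))
        \<le> (((norm (b m))\<^sup>2 + (norm (b k))\<^sup>2) / 2) * (\<kappa> * (1 / (1 + (of_int (m - k))\<^sup>2)))" .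
  qed
  also have "\<dots> = (\<Sum>m\<in>M. \<Sum>k\<in>M. \<kappa> * (norm (b m))\<^sup>2 / 2 * (1 / (1 + (of_int (m - k))\<^sup>2)))
     + (\<Sum>m\<in>M. \<Sum>k\<in>M. \<kappa> * (norm (b k))\<^sup>2 / 2 * (1 / (1 + (of_int (m - k))\<^sup>2)))"
    unfolding sum.distrib[symmetric] by (intro sum.cong refl) (simp add: ring_distribs add_divide_distrib mult.commute)
  also have "(\<Sum>m\<in>M. \<Sum>k\<in>M. \<kappa> * (norm (b k))\<^sup>2 / 2 * (1 / (1 + (of_int (m - k))\<^sup>2)))
           = (\<Sum>m\<in>M. \<Sum>k\<in>M. \<kappa> * (norm (b m))\<^sup>2 / 2 * (1 / (1 + (of_int (m - k))\<^sup>2)))"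
    by (subst sum.swap) (simp add: power2_commute)
  also have "(\<Sum>m\<in>M. \<Sum>k\<in>M. \<kappa> * (norm (b m))\<^sup>2 / 2 * (1 / (1 + (of_int (m - k))\<^sup>2)))
           = (\<Sum>m\<in>M. \<kappa> * (norm (b m))\<^sup>2 / 2 * (\<Sum>k\<in>M. 1 / (1 + (of_int (m - k))\<^sup>2)))"
    by (simp add: sum_distrib_left)
  also have "\<dots> \<le> (\<Sum>m\<in>M. \<kappa> * (norm (b m))\<^sup>2 / 2 * S)"
    using S \<kappa> by (intro sum_mono mult_left_mono) auto
  finally have "Re I \<le> 2 * (\<Sum>m\<in>M. \<kappa> * (norm (b m))\<^sup>2 / 2 * S)" by simp
  also have "\<dots> = \<kappa> * S * (\<Sum>m\<in>M. (norm (b m))\<^sup>2)"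
    by (simp add: sum_distrib_left field_simps)
  finally show "integral\<^sup>L lborel f \<le> \<kappa> * S * (\<Sum>m\<in>M. (norm (b m))\<^sup>2)"
    using hf by (simp add: has_bochner_integral_iff)
qed

text \<open>For \<open>Z = x + cnj y\<close> the imaginary part is within \<open>2 * R\<close> of
  \<open>m - k\<close>, and \<open>\<bar>Z\<bar> * \<bar>Z + 1\<bar>\<close> dominates both the
  square of the imaginary part and \<open>2 * \<delta>\<close>. The former gives the decay, the
  latter covers indices near the diagonal; the constant adds the two contributions.\<close>

lemma norm_inverse_kernel_le:
  fixes x y :: complex and m k :: int
  assumes "\<delta> > 0" "Re x \<ge> \<delta>" "Re y \<ge> \<delta>" "\<bar>Im x - m\<bar> \<le> R" "\<bar>Im y - k\<bar> \<le> R"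
  shows "norm (1 / ((x + cnj y) * (x + cnj y + 1))) \<le> (2 + (1 + 8 * R\<^sup>2) / (2 * \<delta>)) * (1 / (1 + (of_int (m - k))\<^sup>2))"
proof -
  define Z where "Z = x + cnj y"
  define t where "t = \<bar>Im Z\<bar>"
  define N where "N = norm Z * norm (Z + 1)"
  have Z: "norm Z \<ge> 2 * \<delta>" "norm Z \<ge> t" "norm (Z + 1) \<ge> 1" "norm (Z + 1) \<ge> t"
    using complex_Re_le_cmod[of Z] complex_Re_le_cmod[of "Z + 1"] abs_Im_le_cmod[of Z]
      abs_Im_le_cmod[of "Z + 1"] assms by (auto simp: Z_def t_def)
  have t2: "t\<^sup>2 \<le> N"
    unfolding N_def power2_eq_square using Z by (intro mult_mono) (auto simp: t_def)
  have N: "2 * \<delta> * 1 \<le> N"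
    unfolding N_def using Z assms by (intro mult_mono) auto
  have "\<bar>of_int (m - k) :: real\<bar> \<le> t + 2 * R"
    using assms by (auto simp: t_def Z_def)
  then have "(of_int (m - k) :: real)\<^sup>2 \<le> (t + 2 * R)\<^sup>2" by (rule abs_le_square_iff[THEN iffD1, OF order_trans[OF _ abs_ge_self]])
  also have "\<dots> \<le> 2 * t\<^sup>2 + 8 * R\<^sup>2"
    using sum_squares_bound[of t "2 * R"] by (simp add: power2_sum)
  finally have "1 + (of_int (m - k) :: real)\<^sup>2 \<le> 2 * N + (1 + 8 * R\<^sup>2) * 1" using t2 by simp
  also have "\<dots> \<le> 2 * N + (1 + 8 * R\<^sup>2) * (N / (2 * \<delta>))"
    using N assms by (intro add_left_mono mult_left_mono) (auto simp: field_simps)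
  also have "\<dots> = (2 + (1 + 8 * R\<^sup>2) / (2 * \<delta>)) * N" by (simp add: ring_distribs)
  finally have *: "1 + (of_int (m - k) :: real)\<^sup>2 \<le> (2 + (1 + 8 * R\<^sup>2) / (2 * \<delta>)) * N" .
  have "N > 0" using N assms by linarith
  moreover have "1 + (of_int (m - k) :: real)\<^sup>2 > 0" by (simp add: add_pos_nonneg)
  ultimately have "1 / N \<le> (2 + (1 + 8 * R\<^sup>2) / (2 * \<delta>)) * (1 / (1 + (of_int (m - k))\<^sup>2))"
    using * by (simp add: field_simps)
  then show ?thesis by (simp add: N_def Z_def norm_mult norm_divide)
qed

text \<open>\<open>C\<close> is fixed before \<open>K\<close>, \<open>\<phi>\<close> and
  \<open>M\<close>: later \<open>\<phi>\<close> is a difference whose step depends on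
  \<open>T\<close>, and the bound has to be uniform in it. The gap between \<open>\<sigma>1\<close>
  and \<open>\<sigma>2\<close> is what keeps the shifted exponents away from the imaginary
  axis.\<close>

lemma laplace_large_sieve:
  fixes \<sigma>1 \<sigma>2 c R :: real
  assumes "\<sigma>1 < \<sigma>2"
  obtains C where "C > 0" "\<And>K \<beta> \<phi> M (w :: int \<Rightarrow> complex).
    \<lbrakk>\<beta> < \<sigma>1; exp_bdd (-1) K \<beta> \<phi>; finite M;
     \<And>m. m \<in> M \<Longrightarrow> \<sigma>2 \<le> Re (w m) \<and> Re (w m) \<le> c \<and> \<bar>Im (w m) - m\<bar> \<le> R\<rbrakk>
    \<Longrightarrow> (\<Sum>m\<in>M. (norm (laplace \<phi> (w m)))\<^sup>2) \<le> C * (\<integral>u. (\<phi> u)\<^sup>2 * exp (- (2 * \<sigma>1) * u) \<partial>lborel)"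
proof -
  obtain S :: real where S: "S > 0"
    "\<And>M (m :: int). finite M \<Longrightarrow> (\<Sum>k\<in>M. 1 / (1 + (of_int (m - k))\<^sup>2)) \<le> S"
    using sum_inverse_1_plus_square_bounded by blast
  define \<delta> where "\<delta> = \<sigma>2 - \<sigma>1"
  have \<delta>: "\<delta> > 0" using assms by (simp add: \<delta>_def)
  define \<kappa> where "\<kappa> = 2 + (1 + 8 * R\<^sup>2) / (2 * \<delta>)"
  have \<kappa>: "\<kappa> > 0" unfolding \<kappa>_def using \<delta> by (intro add_pos_nonneg) auto
  \<comment> \<open>The exponential is the price of translating the weight by \<open>2\<close>; the
    factor \<open>2\<close> lets the contribution of \<open>P\<close> be absorbed into half of
    \<open>T\<close> at the end.\<close>
  define C where "C = 2 * \<kappa> * S * exp (4 * (c - \<sigma>1))"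
  have C: "C > 0" using \<kappa> S by (simp add: C_def)
  show ?thesis
  proof (rule that[OF C])
    fix K \<beta> \<phi> M and w :: "int \<Rightarrow> complex"
    assume \<beta>: "\<beta> < \<sigma>1" and bd: "exp_bdd (-1) K \<beta> \<phi>" and M: "finite M"
      and w: "\<And>m. m \<in> M \<Longrightarrow> \<sigma>2 \<le> Re (w m) \<and> Re (w m) \<le> c \<and> \<bar>Im (w m) - m\<bar> \<le> R"
    have [measurable]: "\<phi> \<in> borel_measurable borel" by (rule exp_bddD(1)[OF bd])
    have \<phi>0: "\<phi> u = 0" if "u < -1" for u using exp_bddD(2)[OF bd, of u] that by simp
    define D where "D = (\<lambda>m. laplace \<phi> (w m))"
    \<comment> \<open>Subtracting \<open>\<sigma>1\<close> moves the weight
      \<open>exp (- \<sigma>1 * u)\<close> to the side of \<open>\<phi>\<close>; the remaining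
      exponents have real part at least \<open>\<delta>\<close>.\<close>
    define z where "z = (\<lambda>m. w m - of_real \<sigma>1)"
    define P where "P = (\<lambda>u. \<Sum>m\<in>M. cnj (D m) * exp (- (z m * of_real u)))"
    define T where "T = (\<Sum>m\<in>M. (norm (D m))\<^sup>2)"
    \<comment> \<open>The coefficients absorb a translation by \<open>2\<close>: the weight vanishes
      at its left end, which is thereby moved to \<open>-2\<close>, so that it is at least
      \<open>1 / 2\<close> on the range \<open>u \<ge> -1\<close> where \<open>\<phi>\<close>
      lives.\<close>
    define b where "b = (\<lambda>m. cnj (D m) * exp (2 * z m))"
    define W where "W = (\<lambda>v :: real. (1 - exp (- v)) * indicator {0..} v)"
    define f where "f = (\<lambda>v. W v * (norm (\<Sum>m\<in>M. b m * exp (- (z m * of_real v))))\<^sup>2)"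
    have z: "Re (z m) \<ge> \<delta>" "\<bar>Im (z m) - m\<bar> \<le> R" if "m \<in> M" for m
      using w[OF that] by (auto simp: z_def \<delta>_def)
    have Re_pos: "Re (z m) > 0" if "m \<in> M" for m using z(1)[OF that] \<delta> by simp
    have ker: "norm (1 / ((z m + cnj (z k)) * (z m + cnj (z k) + 1))) \<le> \<kappa> * (1 / (1 + (of_int (m - k))\<^sup>2))"
      if "m \<in> M" "k \<in> M" for m k
      unfolding \<kappa>_def by (rule norm_inverse_kernel_le) (use z that \<delta> in auto)
    have f: "integrable lborel f" "integral\<^sup>L lborel f \<le> \<kappa> * S * (\<Sum>m\<in>M. (norm (b m))\<^sup>2)"
      unfolding f_def W_def
      using weighted_exp_sum_norm_square_integral[OF M S(2)[OF M] Re_pos ker, of b] \<kappa> by simp_all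
    have "(\<Sum>m\<in>M. (norm (b m))\<^sup>2) \<le> (\<Sum>m\<in>M. exp (4 * (c - \<sigma>1)) * (norm (D m))\<^sup>2)"
    proof (rule sum_mono)
      fix m assume m: "m \<in> M"
      have "(norm (b m))\<^sup>2 = (norm (D m))\<^sup>2 * exp (4 * Re (z m))"
        by (simp add: b_def norm_mult power_mult_distrib norm_exp_eq_Re exp_of_nat_mult[symmetric])
      also have "\<dots> \<le> (norm (D m))\<^sup>2 * exp (4 * (c - \<sigma>1))"
        using w[OF m] by (intro mult_left_mono) (auto simp: z_def)
      finally show "(norm (b m))\<^sup>2 \<le> exp (4 * (c - \<sigma>1)) * (norm (D m))\<^sup>2" by (simp add: mult.commute)
    qed
    then have "(\<Sum>m\<in>M. (norm (b m))\<^sup>2) \<le> exp (4 * (c - \<sigma>1)) * T"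
      by (simp add: T_def sum_distrib_left)
    then have "\<kappa> * S * (\<Sum>m\<in>M. (norm (b m))\<^sup>2) \<le> \<kappa> * S * (exp (4 * (c - \<sigma>1)) * T)"
      using \<kappa> S by (intro mult_left_mono) auto
    with f(2) have f_le: "2 * integral\<^sup>L lborel f \<le> C * T" by (simp add: C_def)
    have f_shift: "f (2 + 1 * u) = W (u + 2) * (norm (P u))\<^sup>2" for u
    proof -
      have "(\<Sum>m\<in>M. b m * exp (- (z m * of_real (2 + 1 * u)))) = P u"
        unfolding P_def b_def by (intro sum.cong refl) (simp add: algebra_simps exp_add exp_diff exp_minus)
      then show ?thesis by (simp add: f_def add.commute)
    qed
    have int_f: "integrable lborel (\<lambda>u. W (u + 2) * (norm (P u))\<^sup>2)"
      using lborel_integrable_real_affine[OF f(1), of 1 2] by (simp only: f_shift)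
    have lint_f: "(\<integral>u. W (u + 2) * (norm (P u))\<^sup>2 \<partial>lborel) = integral\<^sup>L lborel f"
      using lborel_integral_real_affine[of 1 f 2] unfolding f_shift by simp
    have int_\<phi>: "integrable lborel (\<lambda>u. (\<phi> u)\<^sup>2 * exp (- (2 * \<sigma>1) * u))"
    proof (rule Bochner_Integration.integrable_bound)
      show "integrable lborel (\<lambda>u. K\<^sup>2 * (exp (- (2 * (\<sigma>1 - \<beta>)) * u) * indicator {-1..} u))"
        by (intro integrable_mult_right integrable_exp_atLeast) (use \<beta> in auto)
      show "AE u in lborel. norm ((\<phi> u)\<^sup>2 * exp (- (2 * \<sigma>1) * u))
          \<le> norm (K\<^sup>2 * (exp (- (2 * (\<sigma>1 - \<beta>)) * u) * indicator {-1..} u))"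
      proof (rule AE_I2)
        fix u
        have "(\<phi> u)\<^sup>2 \<le> (K * exp (\<beta> * u) * indicator {-1..} u)\<^sup>2"
          using exp_bddD(2)[OF bd, of u] by (metis abs_ge_self abs_le_square_iff order_trans)
        then have "(\<phi> u)\<^sup>2 * exp (- (2 * \<sigma>1) * u) \<le> (K * exp (\<beta> * u) * indicator {-1..} u)\<^sup>2 * exp (- (2 * \<sigma>1) * u)"
          by (rule mult_right_mono) simp
        also have "\<dots> = K\<^sup>2 * (exp (- (2 * (\<sigma>1 - \<beta>)) * u) * indicator {-1..} u)"
          by (simp add: power_mult_distrib exp_of_nat_mult[symmetric] mult_exp_exp indicator_def algebra_simps
                flip: exp_add)
        finally show "norm ((\<phi> u)\<^sup>2 * exp (- (2 * \<sigma>1) * u))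
          \<le> norm (K\<^sup>2 * (exp (- (2 * (\<sigma>1 - \<beta>)) * u) * indicator {-1..} u))" by simp
      qed
    qed measurable
    \<comment> \<open>duality: the sum of squares is the pairing of \<open>\<phi>\<close> with the exponential sum \<open>P\<close>, whose own mean square
       is at most a constant times the same sum\<close>
    have "of_real T = (\<Sum>m\<in>M. cnj (D m) * D m)"
      unfolding T_def of_real_sum complex_norm_square by (simp add: mult.commute)
    also have "\<dots> = (\<Sum>m\<in>M. \<integral>u. cnj (D m) * (of_real (\<phi> u) * exp (- (w m * of_real u))) \<partial>lborel)"
      by (simp add: D_def laplace_def)
    also have "\<dots> = (\<integral>u. (\<Sum>m\<in>M. cnj (D m) * (of_real (\<phi> u) * exp (- (w m * of_real u)))) \<partial>lborel)"
      using w \<beta> assms by (intro Bochner_Integration.integral_sum[symmetric] integrable_mult_right integrable_laplace[OF bd]) force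
    also have "\<dots> = (\<integral>u. of_real (\<phi> u * exp (- \<sigma>1 * u)) * P u \<partial>lborel)"
      unfolding P_def sum_distrib_left
      by (intro Bochner_Integration.integral_cong sum.cong refl)
         (simp add: z_def algebra_simps exp_of_real[symmetric] flip: exp_add)
    finally have "T \<le> norm (\<integral>u. of_real (\<phi> u * exp (- \<sigma>1 * u)) * P u \<partial>lborel)"
      by (metis norm_of_real abs_ge_self)
    also have "\<dots> \<le> (\<integral>u. (C / 2) * ((\<phi> u)\<^sup>2 * exp (- (2 * \<sigma>1) * u)) + (1 / C) * (W (u + 2) * (norm (P u))\<^sup>2) \<partial>lborel)"
    proof (rule Bochner_Integration.integral_norm_bound_integral)
      show int_g: "integrable lborel (\<lambda>u. (C / 2) * ((\<phi> u)\<^sup>2 * exp (- (2 * \<sigma>1) * u)) + (1 / C) * (W (u + 2) * (norm (P u))\<^sup>2))"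
        by (intro Bochner_Integration.integrable_add integrable_mult_right int_\<phi> int_f)
      show le: "norm (of_real (\<phi> u * exp (- \<sigma>1 * u)) * P u)
          \<le> (C / 2) * ((\<phi> u)\<^sup>2 * exp (- (2 * \<sigma>1) * u)) + (1 / C) * (W (u + 2) * (norm (P u))\<^sup>2)" for u
      proof (cases "u < -1")
        case True
        then show ?thesis using C by (auto simp: \<phi>0 W_def indicator_def)
      next
        case False
        have "exp (- (u + 2)) \<le> exp (- 1 :: real)" using False by simp
        also have "\<dots> \<le> 1 / 2" using exp_ge_add_one_self[of 1] by (simp add: exp_minus field_simps)
        finally have W: "W (u + 2) \<ge> 1 / 2" using False by (simp add: W_def)
        define x y where "x = \<bar>\<phi> u\<bar> * exp (- \<sigma>1 * u)" and "y = norm (P u)"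
        \<comment> \<open>Young's inequality with weight \<open>C\<close>, chosen so that the
          \<open>P\<close> part integrates to at most \<open>T / 2\<close>.\<close>
        have "0 \<le> (C * x - y)\<^sup>2" by simp
        then have "x * y \<le> C / 2 * x\<^sup>2 + 1 / C * (1 / 2 * y\<^sup>2)"
          using C by (simp add: power2_eq_square field_simps)
        also have "\<dots> \<le> C / 2 * x\<^sup>2 + 1 / C * (W (u + 2) * y\<^sup>2)"
          using W C by (intro add_left_mono mult_left_mono mult_right_mono) auto
        also have "x\<^sup>2 = (\<phi> u)\<^sup>2 * exp (- (2 * \<sigma>1) * u)"
          by (simp add: x_def power_mult_distrib exp_of_nat_mult[symmetric] algebra_simps)
        finally show ?thesis by (simp add: x_def y_def norm_mult)
      qed
      show "integrable lborel (\<lambda>u. of_real (\<phi> u * exp (- \<sigma>1 * u)) * P u)"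
      proof (rule Bochner_Integration.integrable_bound[OF int_g])
        show "(\<lambda>u. of_real (\<phi> u * exp (- \<sigma>1 * u)) * P u) \<in> borel_measurable lborel"
          unfolding P_def by measurable
      qed (use order_trans[OF le abs_ge_self] in \<open>auto simp del: of_real_mult\<close>)
    qed
    also have "\<dots> = (C / 2) * (\<integral>u. (\<phi> u)\<^sup>2 * exp (- (2 * \<sigma>1) * u) \<partial>lborel) + (1 / C) * integral\<^sup>L lborel f"
      using int_\<phi> int_f by (simp add: lint_f)
    also have "(1 / C) * integral\<^sup>L lborel f \<le> T / 2" using f_le C by (simp add: field_simps)
    finally have "T \<le> C * (\<integral>u. (\<phi> u)\<^sup>2 * exp (- (2 * \<sigma>1) * u) \<partial>lborel)" by simp
    then show "(\<Sum>m\<in>M. (norm (laplace \<phi> (w m)))\<^sup>2) \<le> C * (\<integral>u. (\<phi> u)\<^sup>2 * exp (- (2 * \<sigma>1) * u) \<partial>lborel)"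
      by (simp add: T_def D_def)
  qed
qed

subsection \<open>Mean squares of Laplace transforms\<close>

lemma exp_bdd_shift_diff:
  assumes bd: "exp_bdd 0 K \<beta> \<phi>" and "\<beta> \<ge> 0" "0 < h" "h \<le> 1"
  shows "exp_bdd (-1) (K * (exp \<beta> + 1)) \<beta> (\<lambda>u. \<phi> (u + h) - \<phi> u)"
  unfolding exp_bdd_def
proof (intro conjI allI)
  have [measurable]: "\<phi> \<in> borel_measurable borel" by (rule exp_bddD(1)[OF bd])
  show "(\<lambda>u. \<phi> (u + h) - \<phi> u) \<in> borel_measurable borel" by measurable
  have K: "K \<ge> 0" using exp_bddD(2)[OF bd, of 0] by (auto intro: order_trans[OF abs_ge_zero])
  fix u :: real
  show "\<bar>\<phi> (u + h) - \<phi> u\<bar> \<le> K * (exp \<beta> + 1) * exp (\<beta> * u) * indicator {- 1..} u"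
  proof (cases "u \<ge> -1")
    case False
    then have "\<phi> (u + h) = 0" "\<phi> u = 0"
      using exp_bddD(2)[OF bd, of u] exp_bddD(2)[OF bd, of "u + h"] assms by auto
    then show ?thesis using False by simp
  next
    case True
    have "\<bar>\<phi> (u + h)\<bar> \<le> K * exp (\<beta> * (u + h)) * indicator {0..} (u + h)" by (rule exp_bddD(2)[OF bd])
    also have "\<dots> \<le> K * exp (\<beta> * (u + h))" using K by (simp add: indicator_def)
    also have "\<dots> \<le> K * exp (\<beta> + \<beta> * u)"
    proof -
      have "\<beta> * h \<le> \<beta> * 1" using assms by (intro mult_left_mono) auto
      then show ?thesis using K by (intro mult_left_mono) (auto simp: algebra_simps)
    qed
    finally have 1: "\<bar>\<phi> (u + h)\<bar> \<le> K * (exp \<beta> * exp (\<beta> * u))" by (simp add: exp_add)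
    have "\<bar>\<phi> u\<bar> \<le> K * exp (\<beta> * u) * indicator {0..} u" by (rule exp_bddD(2)[OF bd])
    also have "\<dots> \<le> K * exp (\<beta> * u)" using K by (simp add: indicator_def)
    finally have 2: "\<bar>\<phi> u\<bar> \<le> K * exp (\<beta> * u)" .
    have "\<bar>\<phi> (u + h) - \<phi> u\<bar> \<le> K * (exp \<beta> * exp (\<beta> * u)) + K * exp (\<beta> * u)" using 1 2 by linarith
    then show ?thesis using True by (simp add: algebra_simps)
  qed
qed

lemma laplace_shift_diff:
  assumes bd: "exp_bdd 0 K \<beta> \<phi>" and s: "Re s > \<beta>"
  shows "laplace (\<lambda>u. \<phi> (u + h) - \<phi> u) s = (exp (s * of_real h) - 1) * laplace \<phi> s"
proof -
  define e :: "real \<Rightarrow> complex" where "e = (\<lambda>u. of_real (\<phi> u) * exp (- (s * of_real u)))"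
  have int: "integrable lborel e" unfolding e_def by (rule integrable_laplace[OF assms])
  have int': "integrable lborel (\<lambda>u. e (h + 1 * u))"
    by (rule lborel_integrable_real_affine[OF int]) simp
  have "laplace (\<lambda>u. \<phi> (u + h) - \<phi> u) s = (\<integral>u. exp (s * of_real h) * e (h + 1 * u) - e u \<partial>lborel)"
    unfolding laplace_def
    by (intro Bochner_Integration.integral_cong refl)
       (simp add: e_def algebra_simps flip: exp_add)
  also have "\<dots> = exp (s * of_real h) * (\<integral>u. e (h + 1 * u) \<partial>lborel) - (\<integral>u. e u \<partial>lborel)"
    using int int' by simp
  also have "(\<integral>u. e (h + 1 * u) \<partial>lborel) = laplace \<phi> s"
    using lborel_integral_real_affine[of 1 e h] by (simp add: laplace_def e_def)
  also have "(\<integral>u. e u \<partial>lborel) = laplace \<phi> s" by (simp add: laplace_def e_def)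
  finally show ?thesis by (simp add: algebra_simps)
qed

lemma norm_laplace_le:
  assumes bd: "exp_bdd 0 K \<beta> \<phi>" and s: "Re s > \<beta>"
  shows "norm (laplace \<phi> s) \<le> K / (Re s - \<beta>)"
proof -
  have "norm (laplace \<phi> s) \<le> (\<integral>u. K * (exp (- (Re s - \<beta>) * u) * indicator {0..} u) \<partial>lborel)"
    unfolding laplace_def
    by (intro Bochner_Integration.integral_norm_bound_integral integrable_laplace[OF bd s]
          norm_laplace_integrand_le[OF bd] integrable_mult_right integrable_exp_atLeast) (use s in auto)
  also have "\<dots> = K / (Re s - \<beta>)" using integrable_exp_atLeast(2)[of "Re s - \<beta>" 0] s by simp
  finally show ?thesis .
qed

lemma laplace_of_real:
  "laplace \<phi> (of_real k) = of_real (\<integral>u. \<phi> u * exp (- k * u) \<partial>lborel)"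
proof -
  have "laplace \<phi> (of_real k) = (\<integral>u. of_real (\<phi> u * exp (- k * u)) \<partial>lborel)"
    unfolding laplace_def by (intro Bochner_Integration.integral_cong refl) (simp flip: exp_of_real)
  then show ?thesis by (simp only: integral_complex_of_real)
qed

lemma exp_minus_1_le:
  fixes x c :: real
  assumes "0 \<le> x" "x \<le> c"
  shows "exp x - 1 \<le> x * exp c"
proof -
  have "1 - x \<le> exp (- x)" using exp_ge_add_one_self[of "- x"] by simp
  then have "(1 - x) * exp x \<le> exp (- x) * exp x" by (intro mult_right_mono) auto
  then have "exp x - 1 \<le> x * exp x" by (simp add: algebra_simps flip: exp_add)
  also have "\<dots> \<le> x * exp c" using assms by (intro mult_left_mono) auto
  finally show ?thesis .
qed

text \<open>
  The first factor in \<open>\<bar>\<Delta>\<phi>\<bar>\<^sup>2 = \<bar>\<Delta>\<phi>\<bar> * \<bar>\<Delta>\<phi>\<bar>\<close> is estimated by the growth of \<open>\<phi>\<close>, the second one by the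
  increment of the monotone function \<open>A + B\<close>, whose weighted integral telescopes to \<open>O(h)\<close>.
\<close>

lemma shift_diff_square_integral_le:
  fixes A B :: "real \<Rightarrow> real"
  assumes "mono A" "mono B"
    and A: "exp_bdd 0 K1 1 A" and B: "exp_bdd 0 K1 1 B"
    and bd: "exp_bdd 0 K \<beta> (\<lambda>u. A u - B u)"
    and \<beta>: "0 \<le> \<beta>" and \<sigma>: "(1 + \<beta>) / 2 < \<sigma>"
  obtains C where "C > 0"
    "\<And>h. 0 < h \<Longrightarrow> h \<le> 1 \<Longrightarrow>
      (\<integral>u. ((A (u + h) - B (u + h)) - (A u - B u))\<^sup>2 * exp (- (2 * \<sigma>) * u) \<partial>lborel) \<le> C * h"
proof -
  \<comment> \<open>The decay left after the growth bound \<open>exp (\<beta> * u)\<close> of the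
    first factor is taken out of \<open>exp (- (2 * \<sigma>) * u)\<close>. The hypothesis on
    \<open>\<sigma>\<close> says exactly \<open>k > 1\<close>, as required for a function
    \<open>H\<close> that is \<open>O(exp u)\<close>.\<close>
  define k where "k = 2 * \<sigma> - \<beta>"
  have k: "k > 1" using \<sigma> by (simp add: k_def field_simps)
  define H where "H = (\<lambda>u. A u + B u)"
  define \<phi> where "\<phi> = (\<lambda>u. A u - B u)"
  have bd: "exp_bdd 0 K \<beta> \<phi>" using bd by (simp add: \<phi>_def)
  have K: "K \<ge> 0" using exp_bddD(2)[OF bd, of 0] by (auto intro: order_trans[OF abs_ge_zero])
  have K1: "K1 \<ge> 0" using exp_bddD(2)[OF A, of 0] by (auto intro: order_trans[OF abs_ge_zero])
  have [measurable]: "A \<in> borel_measurable borel" "B \<in> borel_measurable borel"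
    using A B by (auto dest: exp_bddD(1))
  have [measurable]: "\<phi> \<in> borel_measurable borel" unfolding \<phi>_def by measurable
  have H: "exp_bdd 0 (2 * K1) 1 H"
    unfolding exp_bdd_def H_def
  proof (intro conjI allI)
    fix u show "\<bar>A u + B u\<bar> \<le> 2 * K1 * exp (1 * u) * indicator {0..} u"
      using exp_bddD(2)[OF A, of u] exp_bddD(2)[OF B, of u] by linarith
  qed measurable
  define K2 where "K2 = K * (exp \<beta> + 1)"
  have K2: "K2 \<ge> 0" using K by (simp add: K2_def)
  \<comment> \<open>\<open>k * exp k\<close> bounds \<open>(exp (k * h) - 1) / h\<close> for
    \<open>h \<le> 1\<close>, \<open>2 * K1 / (k - 1)\<close> bounds the transform of
    \<open>H\<close> at \<open>k\<close>, and \<open>+ 1\<close> ensures positivity.\<close>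
  define C where "C = K2 * (k * exp k * (2 * K1 / (k - 1))) + 1"
  have C: "C > 0" unfolding C_def using K2 K1 k by (intro add_nonneg_pos mult_nonneg_nonneg divide_nonneg_nonneg) auto
  show ?thesis
  proof (rule that[OF C])
    fix h :: real assume h: "0 < h" "h \<le> 1"
    note bd' = exp_bdd_shift_diff[OF bd \<beta> h]
    note H' = exp_bdd_shift_diff[OF H _ h]
    have mono: "A u \<le> A (u + h)" "B u \<le> B (u + h)" for u
      using assms(1,2) h by (auto intro: monoD)
    have "integrable lborel (\<lambda>u. Re (of_real (H (u + h) - H u) * exp (- (of_real k * of_real u))))"
      by (intro integrable_Re integrable_laplace[OF H']) (use k in auto)
    also have "(\<lambda>u. Re (of_real (H (u + h) - H u) * exp (- (of_real k * of_real u)))) = (\<lambda>u. (H (u + h) - H u) * exp (- k * u))"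
      by (intro ext) (simp add: Re_exp)
    finally have int: "integrable lborel (\<lambda>u. (H (u + h) - H u) * exp (- k * u))" .
    have le: "(\<phi> (u + h) - \<phi> u)\<^sup>2 * exp (- (2 * \<sigma>) * u) \<le> K2 * ((H (u + h) - H u) * exp (- k * u))" for u
    proof -
      have "\<bar>\<phi> (u + h) - \<phi> u\<bar> \<le> K2 * exp (\<beta> * u) * indicator {-1..} u"
        using exp_bddD(2)[OF bd'] by (simp add: K2_def)
      also have "\<dots> \<le> K2 * exp (\<beta> * u)" using K2 by (simp add: indicator_def)
      finally have 1: "\<bar>\<phi> (u + h) - \<phi> u\<bar> \<le> K2 * exp (\<beta> * u)" .
      have 2: "\<bar>\<phi> (u + h) - \<phi> u\<bar> \<le> H (u + h) - H u"
        using mono[of u] by (simp add: \<phi>_def H_def)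
      have "(\<phi> (u + h) - \<phi> u)\<^sup>2 = \<bar>\<phi> (u + h) - \<phi> u\<bar> * \<bar>\<phi> (u + h) - \<phi> u\<bar>" by (simp add: power2_eq_square)
      also have "\<dots> \<le> (K2 * exp (\<beta> * u)) * (H (u + h) - H u)"
        using 1 2 K2 by (intro mult_mono) auto
      finally have "(\<phi> (u + h) - \<phi> u)\<^sup>2 * exp (- (2 * \<sigma>) * u) \<le> (K2 * exp (\<beta> * u)) * (H (u + h) - H u) * exp (- (2 * \<sigma>) * u)"
        by (rule mult_right_mono) simp
      also have "\<dots> = K2 * ((H (u + h) - H u) * (exp (\<beta> * u) * exp (- (2 * \<sigma>) * u)))"
        by (simp only: mult_ac)
      also have "exp (\<beta> * u) * exp (- (2 * \<sigma>) * u) = exp (- k * u)"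
        by (simp add: k_def algebra_simps flip: exp_add)
      finally show ?thesis .
    qed
    have "(\<integral>u. (\<phi> (u + h) - \<phi> u)\<^sup>2 * exp (- (2 * \<sigma>) * u) \<partial>lborel)
        \<le> (\<integral>u. K2 * ((H (u + h) - H u) * exp (- k * u)) \<partial>lborel)"
    proof (rule integral_mono)
      show int': "integrable lborel (\<lambda>u. K2 * ((H (u + h) - H u) * exp (- k * u)))"
        by (intro integrable_mult_right int)
      show "integrable lborel (\<lambda>u. (\<phi> (u + h) - \<phi> u)\<^sup>2 * exp (- (2 * \<sigma>) * u))"
      proof (rule Bochner_Integration.integrable_bound[OF int'])
        show "AE u in lborel. norm ((\<phi> (u + h) - \<phi> u)\<^sup>2 * exp (- (2 * \<sigma>) * u)) \<le> norm (K2 * ((H (u + h) - H u) * exp (- k * u)))"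
        proof (rule AE_I2)
          fix u
          have "norm ((\<phi> (u + h) - \<phi> u)\<^sup>2 * exp (- (2 * \<sigma>) * u)) = (\<phi> (u + h) - \<phi> u)\<^sup>2 * exp (- (2 * \<sigma>) * u)"
            by simp
          also note le[of u]
          also have "K2 * ((H (u + h) - H u) * exp (- k * u)) \<le> norm (K2 * ((H (u + h) - H u) * exp (- k * u)))"
            unfolding real_norm_def by (rule abs_ge_self)
          finally show "norm ((\<phi> (u + h) - \<phi> u)\<^sup>2 * exp (- (2 * \<sigma>) * u)) \<le> norm (K2 * ((H (u + h) - H u) * exp (- k * u)))" .
        qed
      qed measurable
    qed (rule le)
    also have "\<dots> = K2 * (\<integral>u. (H (u + h) - H u) * exp (- k * u) \<partial>lborel)" by simp
    also have "(\<integral>u. (H (u + h) - H u) * exp (- k * u) \<partial>lborel) \<le> (k * h * exp k) * (2 * K1 / (k - 1))"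
    proof -
      \<comment> \<open>The telescoping: at the real point \<open>k\<close> the transform of the
        increment of \<open>H\<close> is that of \<open>H\<close> times
        \<open>exp (k * h) - 1\<close>, which is of order \<open>h\<close>.\<close>
      have "(\<integral>u. (H (u + h) - H u) * exp (- k * u) \<partial>lborel) \<le> norm (laplace (\<lambda>u. H (u + h) - H u) (of_real k))"
        unfolding laplace_of_real norm_of_real by (rule abs_ge_self)
      also have "\<dots> = norm ((exp (of_real k * of_real h) - 1 :: complex)) * norm (laplace H (of_real k))"
        by (subst laplace_shift_diff[OF H]) (use k in \<open>auto simp: norm_mult\<close>)
      also have "\<dots> \<le> (k * h * exp k) * (2 * K1 / (k - 1))"
      proof (rule mult_mono)
        have "norm (exp (of_real k * of_real h) - 1 :: complex) = \<bar>exp (k * h) - 1\<bar>"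
          by (metis exp_of_real norm_of_real of_real_1 of_real_diff of_real_mult)
        also have "\<dots> = exp (k * h) - 1" using k h by simp
        also have "\<dots> \<le> k * h * exp k" using k h by (intro exp_minus_1_le) auto
        finally show "norm (exp (of_real k * of_real h) - 1 :: complex) \<le> k * h * exp k" .
        show "norm (laplace H (of_real k)) \<le> 2 * K1 / (k - 1)"
          using norm_laplace_le[OF H, of "of_real k"] k by simp
      qed (use k h in auto)
      finally show ?thesis .
    qed
    also have "K2 * ((k * h * exp k) * (2 * K1 / (k - 1))) = (C - 1) * h" by (simp add: C_def)
    also have "\<dots> \<le> C * h" using h by simp
    finally have "(\<integral>u. (\<phi> (u + h) - \<phi> u)\<^sup>2 * exp (- (2 * \<sigma>) * u) \<partial>lborel) \<le> C * h"
      using K2 by (simp add: mult_left_mono)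
    then show "(\<integral>u. ((A (u + h) - B (u + h)) - (A u - B u))\<^sup>2 * exp (- (2 * \<sigma>) * u) \<partial>lborel) \<le> C * h"
      by (simp add: \<phi>_def)
  qed
qed

text \<open>The remainder after the linear term is at most \<open>2 * \<bar>z\<bar>^2\<close>, which
  the bound \<open>1 / 4\<close> turns into half of \<open>\<bar>z\<bar>\<close>. Thus
  \<open>exp (s * h) - 1\<close> can stand in for \<open>s * h\<close> in lower bounds.\<close>

lemma norm_exp_minus_1_ge:
  fixes z :: complex
  assumes "norm z \<le> 1 / 4"
  shows "norm (exp z - 1) \<ge> norm z / 2"
proof -
  have "exp (norm z) \<le> 2"
    using real_exp_bound_lemma[of "norm z"] assms by simp
  then have "norm z ^ 2 * exp (norm z) \<le> norm z ^ 2 * 2" by (intro mult_left_mono) auto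
  moreover have "norm z * norm z \<le> norm z * (1 / 4)" using assms by (intro mult_left_mono) auto
  ultimately have "norm (exp z - 1 - z) \<le> norm z / 2"
    using norm_exp_minus_1_minus_le[of z] by (simp add: power2_eq_square)
  moreover have "norm z \<le> norm (exp z - 1) + norm (exp z - 1 - z)"
    using norm_triangle_ineq4[of "exp z - 1" "exp z - 1 - z"] by simp
  ultimately show ?thesis by linarith
qed

lemma laplace_discrete_mean_square:
  fixes A B :: "real \<Rightarrow> real"
  assumes "mono A" "mono B"
    and A: "exp_bdd 0 K1 1 A" and B: "exp_bdd 0 K1 1 B"
    and bd: "exp_bdd 0 K \<beta> (\<lambda>u. A u - B u)"
    and \<beta>: "0 \<le> \<beta>" "\<beta> < 1" and \<sigma>: "(1 + \<beta>) / 2 < \<sigma>"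
  obtains C where "C > 0" "\<And>T M (w :: int \<Rightarrow> complex).
    \<lbrakk>T \<ge> 1; finite M;
     \<And>m. m \<in> M \<Longrightarrow> \<sigma> \<le> Re (w m) \<and> Re (w m) \<le> c \<and> \<bar>Im (w m) - m\<bar> \<le> R \<and> \<bar>Im (w m)\<bar> \<le> T\<rbrakk>
    \<Longrightarrow> (\<Sum>m\<in>M. (norm (w m * laplace (\<lambda>u. A u - B u) (w m)))\<^sup>2) \<le> C * T"
proof -
  define \<phi> where "\<phi> = (\<lambda>u. A u - B u)"
  \<comment> \<open>The midpoint: strictly above \<open>(1 + \<beta>) / 2\<close> for the difference
    integral, strictly below \<open>\<sigma>\<close> for the gap in the large sieve.\<close>
  define \<sigma>1 where "\<sigma>1 = ((1 + \<beta>) / 2 + \<sigma>) / 2"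
  have \<sigma>1: "(1 + \<beta>) / 2 < \<sigma>1" "\<sigma>1 < \<sigma>" using \<sigma> by (auto simp: \<sigma>1_def field_simps)
  have \<beta>\<sigma>1: "\<beta> < \<sigma>1" using \<sigma>1 \<beta> by (simp add: field_simps)
  obtain C1 where C1: "C1 > 0" "\<And>h. 0 < h \<Longrightarrow> h \<le> 1 \<Longrightarrow>
      (\<integral>u. ((A (u + h) - B (u + h)) - (A u - B u))\<^sup>2 * exp (- (2 * \<sigma>1) * u) \<partial>lborel) \<le> C1 * h"
    using shift_diff_square_integral_le[OF assms(1,2) A B bd \<beta>(1) \<sigma>1(1)] by blast
  obtain C2 where C2: "C2 > 0" "\<And>K \<beta> \<phi> M (w :: int \<Rightarrow> complex).
    \<lbrakk>\<beta> < \<sigma>1; exp_bdd (-1) K \<beta> \<phi>; finite M;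
     \<And>m. m \<in> M \<Longrightarrow> \<sigma> \<le> Re (w m) \<and> Re (w m) \<le> c \<and> \<bar>Im (w m) - m\<bar> \<le> R\<rbrakk>
    \<Longrightarrow> (\<Sum>m\<in>M. (norm (laplace \<phi> (w m)))\<^sup>2) \<le> C2 * (\<integral>u. (\<phi> u)\<^sup>2 * exp (- (2 * \<sigma>1) * u) \<partial>lborel)"
    using laplace_large_sieve[OF \<sigma>1(2), of c R] by blast
  define C where "C = 16 * C1 * C2 * (1 + \<bar>c\<bar>)"
  have C: "C > 0" using C1 C2 by (simp add: C_def)
  show ?thesis
  proof (rule that[OF C])
    fix T M and w :: "int \<Rightarrow> complex"
    assume T: "T \<ge> 1" and M: "finite M" and w: "\<And>m. m \<in> M \<Longrightarrow>
      \<sigma> \<le> Re (w m) \<and> Re (w m) \<le> c \<and> \<bar>Im (w m) - m\<bar> \<le> R \<and> \<bar>Im (w m)\<bar> \<le> T"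
    \<comment> \<open>Chosen so that \<open>\<bar>w m\<bar> * h \<le> 1 / 4\<close> at every sample
      point, while \<open>1 / h\<close> stays \<open>O(T)\<close>.\<close>
    define h where "h = 1 / (4 * (T + \<bar>c\<bar>))"
    have h: "0 < h" "h \<le> 1" using T by (auto simp: h_def field_simps)
    define \<Delta> where "\<Delta> = (\<lambda>u. \<phi> (u + h) - \<phi> u)"
    have bd: "exp_bdd 0 K \<beta> \<phi>" using bd by (simp add: \<phi>_def)
    have "(norm (w m * laplace \<phi> (w m)))\<^sup>2 \<le> (4 / h\<^sup>2) * (norm (laplace \<Delta> (w m)))\<^sup>2" if m: "m \<in> M" for m
    proof -
      have re: "Re (w m) > \<beta>" using w[OF m] \<sigma>1 \<beta>\<sigma>1 by linarith
      have "norm (w m) \<le> T + \<bar>c\<bar>"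
        using cmod_le[of "w m"] w[OF m] re \<beta> by linarith
      then have "norm (w m) * h \<le> (T + \<bar>c\<bar>) * h" using h by (intro mult_right_mono) auto
      also have "\<dots> = 1 / 4" using T by (simp add: h_def field_simps)
      finally have "norm (w m * of_real h) \<le> 1 / 4" using h by (simp add: norm_mult)
      then have "norm (w m * of_real h) / 2 \<le> norm (exp (w m * of_real h) - 1)"
        by (rule norm_exp_minus_1_ge)
      then have "norm (w m) * h / 2 * norm (laplace \<phi> (w m)) \<le> norm (exp (w m * of_real h) - 1) * norm (laplace \<phi> (w m))"
        using h by (intro mult_right_mono) (auto simp: norm_mult)
      also have "\<dots> = norm (laplace \<Delta> (w m))"
        unfolding \<Delta>_def laplace_shift_diff[OF bd re] by (simp add: norm_mult)
      finally have "norm (w m * laplace \<phi> (w m)) \<le> 2 / h * norm (laplace \<Delta> (w m))"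
        using h by (simp add: norm_mult field_simps)
      then have "(norm (w m * laplace \<phi> (w m)))\<^sup>2 \<le> (2 / h * norm (laplace \<Delta> (w m)))\<^sup>2"
        by (intro power_mono) auto
      then show ?thesis by (simp add: power_mult_distrib power_divide)
    qed
    then have "(\<Sum>m\<in>M. (norm (w m * laplace \<phi> (w m)))\<^sup>2) \<le> (\<Sum>m\<in>M. (4 / h\<^sup>2) * (norm (laplace \<Delta> (w m)))\<^sup>2)"
      by (rule sum_mono)
    also have "\<dots> = (4 / h\<^sup>2) * (\<Sum>m\<in>M. (norm (laplace \<Delta> (w m)))\<^sup>2)" by (simp add: sum_distrib_left)
    also have "\<dots> \<le> (4 / h\<^sup>2) * (C2 * (C1 * h))"
    proof (rule mult_left_mono)
      have "exp_bdd (-1) (K * (exp \<beta> + 1)) \<beta> \<Delta>"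
        unfolding \<Delta>_def by (rule exp_bdd_shift_diff[OF bd \<beta>(1) h])
      then have "(\<Sum>m\<in>M. (norm (laplace \<Delta> (w m)))\<^sup>2) \<le> C2 * (\<integral>u. (\<Delta> u)\<^sup>2 * exp (- (2 * \<sigma>1) * u) \<partial>lborel)"
        using w by (intro C2(2)[OF \<beta>\<sigma>1 _ M]) auto
      also have "\<dots> \<le> C2 * (C1 * h)"
        using C1(2)[OF h] C2(1) by (intro mult_left_mono) (auto simp: \<Delta>_def \<phi>_def)
      finally show "(\<Sum>m\<in>M. (norm (laplace \<Delta> (w m)))\<^sup>2) \<le> C2 * (C1 * h)" .
    qed auto
    also have "\<dots> = 4 * C1 * C2 * (1 / h)" using h by (simp add: power2_eq_square)
    also have "1 / h = 4 * (T + \<bar>c\<bar>)" by (simp add: h_def)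
    also have "4 * C1 * C2 * (4 * (T + \<bar>c\<bar>)) \<le> 4 * C1 * C2 * (4 * ((1 + \<bar>c\<bar>) * T))"
    proof (intro mult_left_mono)
      have "\<bar>c\<bar> * 1 \<le> \<bar>c\<bar> * T" using T by (intro mult_left_mono) auto
      then show "T + \<bar>c\<bar> \<le> (1 + \<bar>c\<bar>) * T" by (simp add: algebra_simps)
    qed (use C1 C2 in auto)
    also have "\<dots> = C * T" by (simp add: C_def)
    finally show "(\<Sum>m\<in>M. (norm (w m * laplace (\<lambda>u. A u - B u) (w m)))\<^sup>2) \<le> C * T"
      by (simp add: \<phi>_def)
  qed
qed

subsection \<open>Zeros in a disc\<close>

text \<open>Near \<open>a\<close> the quotient is \<open>zor_poly\<close>, elsewhere it is the
  explicit fraction; both are holomorphic and agree on the overlap, so they glue to a holomorphic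
  function on all of \<open>S\<close>.\<close>

lemma holomorphic_factor_zorder:
  fixes q :: "complex \<Rightarrow> complex"
  assumes S: "q holomorphic_on S" "open S" "connected S" "a \<in> S" and nz: "\<exists>w\<in>S. q w \<noteq> 0"
  obtains g where "g holomorphic_on S" "\<And>w. w \<in> S \<Longrightarrow> q w = g w * (w - a) ^ nat (zorder q a)"
proof -
  define k where "k = nat (zorder q a)"
  obtain r where r: "r > 0" "cball a r \<subseteq> S" "zor_poly q a holomorphic_on cball a r"
    "\<And>w. w \<in> cball a r \<Longrightarrow> q w = zor_poly q a w * (w - a) ^ k"
    using zorder_exist_zero[OF S nz, THEN conjunct2] unfolding k_def by blast
  define g where "g = (\<lambda>w. if w \<in> ball a r then zor_poly q a w else q w / (w - a) ^ k)"
  have "g holomorphic_on ball a r \<union> (S - {a})"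
  proof (rule holomorphic_on_Un)
    have "zor_poly q a holomorphic_on ball a r"
      using r(3) by (rule holomorphic_on_subset) auto
    then show "g holomorphic_on ball a r"
      by (rule holomorphic_transform) (simp add: g_def)
    have "(\<lambda>w. q w / (w - a) ^ k) holomorphic_on S - {a}"
      by (intro holomorphic_intros holomorphic_on_subset[OF S(1)]) auto
    then show "g holomorphic_on S - {a}"
      by (rule holomorphic_transform) (use r(4) in \<open>auto simp: g_def\<close>)
  qed (use S(2) in auto)
  moreover have "ball a r \<union> (S - {a}) = S" using r S(4) by auto
  ultimately have "g holomorphic_on S" by simp
  moreover have "q w = g w * (w - a) ^ k" if "w \<in> S" for w
    using that r(1,4) by (auto simp: g_def)
  ultimately show ?thesis using that by (simp add: k_def)
qed

text \<open>Zeros are divided out one at a time. The order at the next point \<open>a\<close> is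
  unaffected by the earlier factors, since they do not vanish at \<open>a\<close>, so the exponents
  may be read off from \<open>f\<close> itself.\<close>

lemma holomorphic_factor_zorder_prod:
  fixes f :: "complex \<Rightarrow> complex"
  assumes "finite Z" "Z \<subseteq> S" and S: "f holomorphic_on S" "open S" "connected S"
    and nz: "\<exists>w\<in>S. f w \<noteq> 0"
  shows "\<exists>g. g holomorphic_on S \<and> (\<forall>w\<in>S. f w = g w * (\<Prod>z\<in>Z. (w - z) ^ nat (zorder f z)))"
  using assms(1,2)
proof (induction Z)
  case empty
  then show ?case using S by auto
next
  case (insert a Z)
  then obtain g where g: "g holomorphic_on S" "\<And>w. w \<in> S \<Longrightarrow> f w = g w * (\<Prod>z\<in>Z. (w - z) ^ nat (zorder f z))"
    by auto
  define P where "P = (\<lambda>w. \<Prod>z\<in>Z. (w - z) ^ nat (zorder f z))"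
  have a: "a \<in> S" using insert by auto
  have gnz: "\<exists>w\<in>S. g w \<noteq> 0" using nz g(2) by auto
  have Pa: "P analytic_on {a}" unfolding P_def by (intro analytic_intros)
  have P0: "P a \<noteq> 0" using insert by (auto simp: P_def)
  have ga: "g analytic_on {a}" using g(1) S a analytic_at by blast
  have "zorder f a = zorder (\<lambda>w. g w * P w) a"
  proof (rule zorder_cong)
    show "\<forall>\<^sub>F w in at a. f w = g w * P w"
      using eventually_at_in_open'[OF S(2) a] by eventually_elim (simp add: g(2) P_def)
  qed auto
  also have "\<dots> = zorder g a + zorder P a"
  proof (rule zorder_times_analytic[OF ga Pa])
    obtain w0 where w0: "w0 \<in> S" "f w0 \<noteq> 0" using nz by auto
    have "\<forall>\<^sub>F w in at a. f w \<noteq> 0 \<and> w \<in> S"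
      by (rule non_zero_neighbour_alt[OF S a w0])
    then show "\<forall>\<^sub>F w in at a. g w * P w \<noteq> 0"
      by eventually_elim (auto simp: g(2) P_def)
  qed
  also have "zorder P a = 0" by (rule zorder_eq_0I[OF Pa P0])
  finally have zo: "zorder f a = zorder g a" by simp
  obtain g' where "g' holomorphic_on S" "\<And>w. w \<in> S \<Longrightarrow> g w = g' w * (w - a) ^ nat (zorder g a)"
    using holomorphic_factor_zorder[OF g(1) S(2,3) a gnz] by blast
  then show ?case using g(2) insert.hyps by (auto simp: zo intro!: exI[of _ g'])
qed

text \<open>
  Multiplying by \<open>(R\<^sup>2 - cnj z * w) / (R * (w - z))\<close> for every zero \<open>z\<close> (a Blaschke factor) does not change \<open>\<bar>f\<bar>\<close>
  on the circle of radius \<open>R\<close>, but increases it at the centre.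
\<close>

lemma jensen_zero_bound:
  fixes f :: "complex \<Rightarrow> complex"
  assumes S: "f holomorphic_on S" "open S" "connected S" and cS: "cball c R \<subseteq> S"
    and r: "0 < r" "r < R" and Z: "finite Z" "\<And>z. z \<in> Z \<Longrightarrow> dist c z \<le> r"
    and M: "\<And>w. dist c w = R \<Longrightarrow> norm (f w) \<le> M" and fc: "f c \<noteq> 0"
  shows "norm (f c) * (R / r) ^ (\<Sum>z\<in>Z. nat (zorder f z)) \<le> M"
proof -
  define k where "k = (\<lambda>z. nat (zorder f z))"
  have "Z \<subseteq> S" using Z(2) r cS by force
  moreover have "c \<in> S" using cS r by auto
  ultimately obtain g where g: "g holomorphic_on S" "\<And>w. w \<in> S \<Longrightarrow> f w = g w * (\<Prod>z\<in>Z. (w - z) ^ k z)"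
    using holomorphic_factor_zorder_prod[OF Z(1) _ S] fc unfolding k_def by blast
  \<comment> \<open>This is \<open>f\<close> times its Blaschke factors, with every
    \<open>w - z\<close> already cancelled, so that holomorphy on \<open>S\<close> is
    immediate.\<close>
  define b where "b = (\<lambda>w. g w * (\<Prod>z\<in>Z. ((R\<^sup>2 - cnj (z - c) * (w - c)) / R) ^ k z))"
  have hb: "b holomorphic_on S" unfolding b_def using r by (intro holomorphic_intros g(1)) auto
  have "norm (b c) \<le> M"
  proof (rule maximum_modulus_frontier[of b "cball c R"])
    show "b holomorphic_on interior (cball c R)"
      by (rule holomorphic_on_subset[OF hb order_trans[OF interior_subset cS]])
    show "continuous_on (closure (cball c R)) b"
      using holomorphic_on_imp_continuous_on[OF holomorphic_on_subset[OF hb cS]] by simp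
    show "norm (b w) \<le> M" if "w \<in> frontier (cball c R)" for w
    proof -
      have w: "dist c w = R" using that r by (simp add: frontier_cball)
      have eq: "norm ((R\<^sup>2 - cnj (z - c) * (w - c)) / R) = norm (w - z)" for z
      proof -
        have "of_real (R\<^sup>2) = (w - c) * cnj (w - c)"
          using w complex_norm_square[of "w - c"] by (simp add: dist_norm norm_minus_commute)
        then have "of_real (R\<^sup>2) - cnj (z - c) * (w - c) = (w - c) * cnj (w - z)"
          by (simp add: algebra_simps)
        then have "norm ((R\<^sup>2 - cnj (z - c) * (w - c)) / R) = norm (w - c) * norm (w - z) / R"
          using r by (simp only: norm_divide norm_mult complex_mod_cnj norm_of_real)
        then show ?thesis using w r by (simp add: dist_norm norm_minus_commute)
      qed
      have "w \<in> S" using w cS by auto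
      have "norm (b w) = norm (g w) * (\<Prod>z\<in>Z. norm ((R\<^sup>2 - cnj (z - c) * (w - c)) / R) ^ k z)"
        unfolding b_def norm_mult prod_norm[symmetric] norm_power ..
      also have "\<dots> = norm (f w)"
        unfolding g(2)[OF \<open>w \<in> S\<close>] norm_mult prod_norm[symmetric] norm_power eq ..
      finally have "norm (b w) = norm (f w)" .
      then show ?thesis using M[OF w] by simp
    qed
  qed (use r in auto)
  \<comment> \<open>At the centre each new factor has modulus \<open>R\<close>, while the old one
    was \<open>\<bar>c - z\<bar> \<le> r\<close>; every zero, counted with multiplicity, thus gains
    at least \<open>R / r\<close>.\<close>
  have "norm (b c) = norm (g c) * (\<Prod>z\<in>Z. R ^ k z)"
    unfolding b_def norm_mult prod_norm[symmetric] norm_power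
    using r by (simp add: norm_divide power2_eq_square)
  also have "(\<Prod>z\<in>Z. R ^ k z) = R ^ (\<Sum>z\<in>Z. k z)" by (rule power_sum[symmetric])
  finally have bc: "norm (g c) * R ^ (\<Sum>z\<in>Z. k z) \<le> M" using \<open>norm (b c) \<le> M\<close> by simp
  have "norm (f c) = norm (g c) * (\<Prod>z\<in>Z. norm (c - z) ^ k z)"
    unfolding g(2)[OF \<open>c \<in> S\<close>] norm_mult prod_norm[symmetric] norm_power ..
  also have "\<dots> \<le> norm (g c) * (\<Prod>z\<in>Z. r ^ k z)"
    using Z(2) by (intro mult_left_mono prod_mono) (auto intro!: power_mono simp: dist_norm)
  also have "(\<Prod>z\<in>Z. r ^ k z) = r ^ (\<Sum>z\<in>Z. k z)" by (rule power_sum[symmetric])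
  finally have "norm (f c) * (R / r) ^ (\<Sum>z\<in>Z. k z) \<le> norm (g c) * r ^ (\<Sum>z\<in>Z. k z) * (R / r) ^ (\<Sum>z\<in>Z. k z)"
    using r by (intro mult_right_mono) auto
  also have "\<dots> = norm (g c) * R ^ (\<Sum>z\<in>Z. k z)" using r by (simp add: power_divide)
  finally show ?thesis using bc by (simp add: k_def)
qed

text \<open>Bernoulli's inequality replaces the usual logarithm: \<open>(R / r) ^ n\<close> is at
  least \<open>n * (R / r - 1)\<close>, so the count is linear in \<open>M\<close>. Linearity suits
  a maximum that is known only in mean square over many discs.\<close>

lemma jensen_zero_count_le:
  fixes f :: "complex \<Rightarrow> complex"
  assumes S: "f holomorphic_on S" "open S" "connected S" and cS: "cball c R \<subseteq> S"
    and r: "0 < r" "r < R" and Z: "finite Z" "\<And>z. z \<in> Z \<Longrightarrow> dist c z \<le> r"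
    and M: "\<And>w. dist c w = R \<Longrightarrow> norm (f w) \<le> M" and fc: "\<mu> \<le> norm (f c)" "\<mu> > 0"
  shows "real (\<Sum>z\<in>Z. nat (zorder f z)) \<le> M * (r / ((R - r) * \<mu>))"
proof -
  define n where "n = (\<Sum>z\<in>Z. nat (zorder f z))"
  have "norm (f c) * (R / r) ^ n \<le> M"
    unfolding n_def using fc by (intro jensen_zero_bound[OF S cS r Z M]) auto
  moreover have "real n * (R / r - 1) \<le> (R / r) ^ n"
    using Bernoulli_inequality[of "R / r - 1" n] r by simp
  then have "\<mu> * (real n * (R / r - 1)) \<le> norm (f c) * (R / r) ^ n"
    using fc r by (intro mult_mono) auto
  ultimately have "\<mu> * (real n * (R / r - 1)) \<le> M" by linarith
  then show ?thesis using fc r unfolding n_def[symmetric] by (simp add: field_simps)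
qed

subsection \<open>Dirichlet series with regular coefficient sums\<close>

locale regular_dirichlet_series =
  fixes n a :: "nat \<Rightarrow> real" and \<rho> \<beta> :: real
  assumes n_mono: "strict_mono n" and n_unbounded: "\<not> bdd_above (range n)"
    and n_pos: "\<And>j. n j > 0" and a_pos: "\<And>j. a j > 0"
    and \<rho>: "\<rho> > 0" and \<beta>: "0 \<le> \<beta>" "\<beta> < 1"
    and summatory_asymp: "(\<lambda>x. summatory a n x - \<rho> * x) \<in> O[at_top](\<lambda>x. x powr \<beta>)"
begin

text \<open>Dividing by \<open>n 0\<close> makes all exponents nonnegative, also when
  \<open>n 0 < 1\<close>, so the summatory function vanishes for \<open>u < 0\<close>.\<close>

definition lam :: "nat \<Rightarrow> real" where "lam j = ln (n j / n 0)"

definition A :: "real \<Rightarrow> real" where "A u = summatory a n (n 0 * exp u)"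

text \<open>The main term is cut off at \<open>u = 0\<close> as well, so that \<open>A - B\<close>
  is supported on \<open>u \<ge> 0\<close>. The transform of the cut-off main term is the simple
  pole at \<open>1\<close>.\<close>

definition B :: "real \<Rightarrow> real" where "B u = \<rho> * n 0 * exp u * indicator {0..} u"

definition L :: "complex \<Rightarrow> complex" where "L = laplace (\<lambda>u. A u - B u)"

section \<open>Growth and monotonicity of the summatory function and its main term\<close>

lemma finite_le: "finite {j. n j \<le> x}"
proof -
  obtain k where k: "n k > x"
    using n_unbounded by (auto simp: bdd_above_def not_le)
  have "{j. n j \<le> x} \<subseteq> {..<k}"
  proof
    fix j assume "j \<in> {j. n j \<le> x}"
    then have "n j < n k" using k by simp
    then show "j \<in> {..<k}" by (simp add: strict_mono_less[OF n_mono])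
  qed
  then show ?thesis by (rule finite_subset) simp
qed

lemma n_eq: "n j = n 0 * exp (lam j)"
  using n_pos[of j] n_pos[of 0] by (simp add: lam_def)

lemma n_le_iff: "n j \<le> n 0 * exp u \<longleftrightarrow> lam j \<le> u"
  using n_pos[of 0] by (simp add: n_eq[of j])

lemma lam_0: "lam 0 = 0"
  using n_pos[of 0] by (simp add: lam_def)

lemma lam_mono: "i \<le> j \<Longrightarrow> lam i \<le> lam j"
  using n_pos[of 0] n_pos[of i] n_pos[of j] by (simp add: lam_def strict_mono_less_eq[OF n_mono] divide_right_mono)

lemma lam_1_pos: "lam (Suc 0) > 0"
  using n_pos[of 0] strict_monoD[OF n_mono, of 0 "Suc 0"] by (simp add: lam_def)

lemma lam_nonneg: "lam j \<ge> 0"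
  using lam_mono[of 0 j] by (simp add: lam_0)

lemma finite_lam_le: "finite {j. lam j \<le> u}"
  using finite_le[of "n 0 * exp u"] by (simp add: n_le_iff)

lemma A_eq: "A u = (\<Sum>j | lam j \<le> u. a j)"
  by (simp add: A_def summatory_def n_le_iff)

lemma mono_A: "mono A"
  unfolding A_eq using a_pos by (intro monoI sum_mono2 finite_lam_le) (auto intro: less_imp_le)

lemma A_nonneg: "A u \<ge> 0"
  unfolding A_eq using a_pos by (intro sum_nonneg) (auto intro: less_imp_le)

lemma A_eq_0: "u < 0 \<Longrightarrow> A u = 0"
  unfolding A_eq using lam_nonneg by (intro sum.neutral) (auto simp: not_le[symmetric] intro: order_trans)

lemma mono_B: "mono B"
  using \<rho> n_pos[of 0] by (intro monoI) (auto simp: B_def indicator_def)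

lemma measurable_AB [measurable]: "A \<in> borel_measurable borel" "B \<in> borel_measurable borel"
  using mono_A mono_B by (auto intro: borel_measurable_mono)

text \<open>The asymptotics speak only about large \<open>x\<close>. On the remaining bounded range
  both terms are at most their values at \<open>X\<close>, and
  \<open>exp (\<beta> * u) \<ge> 1\<close> for \<open>u \<ge> 0\<close> because
  \<open>\<beta> \<ge> 0\<close>.\<close>

lemma A_minus_B_bdd: "\<exists>K. exp_bdd 0 K \<beta> (\<lambda>u. A u - B u)"
proof -
  obtain c where c: "c > 0" "\<forall>\<^sub>F x in at_top. norm (summatory a n x - \<rho> * x) \<le> c * norm (x powr \<beta>)"
    using landau_o.bigE[OF summatory_asymp] by blast
  then obtain X0 where X0: "\<And>x. x \<ge> X0 \<Longrightarrow> \<bar>summatory a n x - \<rho> * x\<bar> \<le> c * x powr \<beta>"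
    by (auto simp: eventually_at_top_linorder)
  define X where "X = max X0 0"
  define K where "K = c * n 0 powr \<beta> + summatory a n X + \<rho> * X"
  have SX: "summatory a n X \<ge> 0" unfolding summatory_def using a_pos by (intro sum_nonneg) (auto intro: less_imp_le)
  have X: "\<rho> * X \<ge> 0" "X \<ge> X0" using \<rho> by (auto simp: X_def)
  have "\<bar>A u - B u\<bar> \<le> K * exp (\<beta> * u)" if u: "u \<ge> 0" for u
  proof -
    define x where "x = n 0 * exp u"
    have x: "x > 0" using n_pos[of 0] by (simp add: x_def)
    have eq: "A u - B u = summatory a n x - \<rho> * x" using u by (simp add: A_def B_def x_def)
    have xb: "x powr \<beta> = n 0 powr \<beta> * exp (\<beta> * u)"
      using n_pos[of 0] by (simp add: x_def powr_mult exp_powr_real mult.commute)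
    have e1: "exp (\<beta> * u) \<ge> 1" using \<beta> u by simp
    show ?thesis
    proof (cases "x \<ge> X")
      case True
      then have "\<bar>A u - B u\<bar> \<le> (c * n 0 powr \<beta>) * exp (\<beta> * u)"
        using X0[of x] X by (simp add: eq xb)
      also have "\<dots> \<le> K * exp (\<beta> * u)" using SX X by (intro mult_right_mono) (auto simp: K_def)
      finally show ?thesis .
    next
      case False
      have "summatory a n x \<le> summatory a n X"
        unfolding summatory_def using False a_pos
        by (intro sum_mono2 finite_le) (auto intro: less_imp_le)
      moreover have "summatory a n x \<ge> 0" unfolding summatory_def using a_pos by (intro sum_nonneg) (auto intro: less_imp_le)
      moreover have "0 \<le> \<rho> * x" "\<rho> * x \<le> \<rho> * X" using False \<rho> x by auto
      ultimately have "\<bar>A u - B u\<bar> \<le> summatory a n X + \<rho> * X" unfolding eq by linarith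
      also have "\<dots> \<le> K * 1" using c by (simp add: K_def)
      also have "\<dots> \<le> K * exp (\<beta> * u)" using e1 SX X c by (intro mult_left_mono) (auto simp: K_def)
      finally show ?thesis .
    qed
  qed
  then have "\<bar>A u - B u\<bar> \<le> K * exp (\<beta> * u) * indicator {0..} u" for u
    by (cases "u \<ge> 0") (auto simp: A_eq_0 B_def)
  then have "exp_bdd 0 K \<beta> (\<lambda>u. A u - B u)" by (simp add: exp_bdd_def)
  then show ?thesis ..
qed

lemma A_B_bdd: "\<exists>K. exp_bdd 0 K 1 A \<and> exp_bdd 0 K 1 B"
proof -
  obtain K where K: "exp_bdd 0 K \<beta> (\<lambda>u. A u - B u)" using A_minus_B_bdd by blast
  have K0: "K \<ge> 0" using exp_bddD(2)[OF K, of 0] by (auto intro: order_trans[OF abs_ge_zero])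
  have "\<bar>A u\<bar> \<le> (K + \<rho> * n 0) * exp (1 * u) * indicator {0..} u \<and> \<bar>B u\<bar> \<le> (K + \<rho> * n 0) * exp (1 * u) * indicator {0..} u" for u
  proof (cases "u \<ge> 0")
    case True
    have "\<bar>A u - B u\<bar> \<le> K * exp (\<beta> * u)" using exp_bddD(2)[OF K, of u] True by simp
    also have "\<dots> \<le> K * exp u" using K0 True \<beta> by (intro mult_left_mono) (auto simp: mult_left_le_one_le)
    finally have "\<bar>A u - B u\<bar> \<le> K * exp u" .
    moreover have "B u = \<rho> * n 0 * exp u" "B u \<ge> 0" using True \<rho> n_pos[of 0] by (auto simp: B_def)
    moreover have "K * exp u \<ge> 0" using K0 by simp
    ultimately show ?thesis using True by (auto simp: ring_distribs)
  qed (auto simp: A_eq_0 B_def)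
  then show ?thesis by (auto simp: exp_bdd_def intro!: exI[of _ "K + \<rho> * n 0"])
qed

section \<open>The series as a Laplace transform and its analytic continuation\<close>

lemma exp_series_sums:
  assumes s: "Re s > 1"
  shows "(\<lambda>j. of_real (a j) * exp (- (s * of_real (lam j)))) sums (s * laplace A s)"
proof -
  obtain K where K: "exp_bdd 0 K 1 A" using A_B_bdd by blast
  \<comment> \<open>Truncated step functions with positive jumps: each is dominated by
    \<open>A\<close> and agrees with it at \<open>u\<close> once all jumps up to \<open>u\<close>
    are included. Dominated convergence then yields convergence of the series together with its
    value.\<close>
  define AN where "AN = (\<lambda>N u. \<Sum>j<N. a j * indicator {lam j..} u)"
  have lap: "laplace (AN N) s = (\<Sum>j<N. of_real (a j) * (exp (- (s * of_real (lam j))) / s))" for N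
  proof -
    have int: "integrable lborel (\<lambda>u. of_real (indicator {lam j..} u) * exp (- (s * of_real u)) :: complex)" for j
      by (rule integrable_laplace[of "lam j" 1 0]) (use s in \<open>auto simp: exp_bdd_def\<close>)
    have "laplace (AN N) s = (\<integral>u. (\<Sum>j<N. of_real (a j) * (of_real (indicator {lam j..} u) * exp (- (s * of_real u)))) \<partial>lborel)"
      unfolding laplace_def AN_def
      by (intro Bochner_Integration.integral_cong refl) (simp add: sum_distrib_right mult.assoc del: sum_mult_indicator)
    also have "\<dots> = (\<Sum>j<N. of_real (a j) * laplace (indicator {lam j..}) s)"
      unfolding laplace_def using int by (subst Bochner_Integration.integral_sum) auto
    also have "\<dots> = (\<Sum>j<N. of_real (a j) * (exp (- (s * of_real (lam j))) / s))"
      using s by (intro sum.cong refl) (simp add: laplace_indicator)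
    finally show ?thesis .
  qed
  have AN_eq: "AN N u = (\<Sum>j\<in>{..<N} \<inter> {j. lam j \<le> u}. a j)" for N u
    unfolding AN_def by (intro sum.mono_neutral_cong_right) auto
  have AN_le: "\<bar>AN N u\<bar> \<le> A u" for N u
  proof -
    have "0 \<le> AN N u" unfolding AN_eq using a_pos by (intro sum_nonneg) (auto intro: less_imp_le)
    moreover have "AN N u \<le> A u" unfolding AN_eq A_eq
      using a_pos by (intro sum_mono2 finite_lam_le) (auto intro: less_imp_le)
    ultimately show ?thesis by simp
  qed
  have lim: "(\<lambda>N. AN N u) \<longlonglongrightarrow> A u" for u
  proof (rule tendsto_eventually)
    obtain N0 where N0: "{j. lam j \<le> u} \<subseteq> {..<N0}"
      using finite_nat_iff_bounded[of "{j. lam j \<le> u}"] finite_lam_le by blast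
    then have "AN N u = A u" if "N \<ge> N0" for N
      unfolding AN_eq A_eq using that by (intro sum.cong) auto
    then show "\<forall>\<^sub>F N in sequentially. AN N u = A u" by (auto simp: eventually_sequentially)
  qed
  have "(\<lambda>N. laplace (AN N) s) \<longlonglongrightarrow> laplace A s"
    unfolding laplace_def
  proof (rule integral_dominated_convergence)
    show "integrable lborel (\<lambda>u. norm (of_real (A u) * exp (- (s * of_real u)) :: complex))"
      by (intro integrable_norm integrable_laplace[OF K s])
    show "(\<lambda>u. of_real (AN N u) * exp (- (s * of_real u)) :: complex) \<in> borel_measurable lborel" for N
      unfolding AN_def by measurable
    show "AE u in lborel. (\<lambda>N. of_real (AN N u) * exp (- (s * of_real u)) :: complex) \<longlonglongrightarrow> of_real (A u) * exp (- (s * of_real u))"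
      by (intro AE_I2 tendsto_intros lim)
    show "AE u in lborel. norm (of_real (AN N u) * exp (- (s * of_real u)) :: complex) \<le> norm (of_real (A u) * exp (- (s * of_real u)) :: complex)" for N
      using AN_le A_nonneg by (intro AE_I2) (auto simp: norm_mult intro!: mult_right_mono)
  qed measurable
  then have "(\<lambda>N. s * laplace (AN N) s) \<longlonglongrightarrow> s * laplace A s" by (intro tendsto_intros)
  moreover have "s * laplace (AN N) s = (\<Sum>j<N. of_real (a j) * exp (- (s * of_real (lam j))))" for N
  proof -
    have "s \<noteq> 0" using s by auto
    then show ?thesis unfolding lap sum_distrib_left by (intro sum.cong refl) simp
  qed
  ultimately show ?thesis by (simp add: sums_def)
qed

lemma dirichlet_term_eq:
  fixes s :: complex
  shows "of_real (a j) * of_real (n j) powr (- s) = exp (- (s * of_real (ln (n 0)))) * (of_real (a j) * exp (- (s * of_real (lam j))))"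
proof -
  have "ln (n j) = ln (n 0) + lam j"
    using n_pos[of 0] n_pos[of j] by (simp add: lam_def ln_div)
  then show ?thesis
    using n_pos[of j] by (simp add: powr_def Ln_of_real algebra_simps flip: exp_add)
qed

lemma dirichlet_sum_eq:
  assumes "Re s > 1"
  shows "dirichlet_sum a n s = exp (- (s * of_real (ln (n 0)))) * (s * laplace A s)"
  unfolding dirichlet_sum_def dirichlet_term_eq
  using sums_mult[OF exp_series_sums[OF assms]] by (rule sums_unique[symmetric])

lemma laplace_A_eq:
  assumes s: "Re s > 1"
  shows "laplace A s = L s + of_real (\<rho> * n 0) / (s - 1)"
proof -
  obtain K where K: "exp_bdd 0 K 1 A" "exp_bdd 0 K 1 B" using A_B_bdd by blast
  have "L s = laplace A s - laplace B s"
    unfolding L_def laplace_def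
    by (subst Bochner_Integration.integral_diff[symmetric])
       (auto intro!: integrable_laplace[OF K(1) s] integrable_laplace[OF K(2) s] simp: left_diff_distrib)
  moreover have "laplace B s = (\<integral>u. of_real (\<rho> * n 0) * (of_real (indicator {0..} u) * exp (- ((s - 1) * of_real u))) \<partial>lborel)"
    unfolding laplace_def
    by (intro Bochner_Integration.integral_cong refl)
       (simp add: B_def indicator_def algebra_simps flip: exp_of_real exp_add)
  then have "laplace B s = of_real (\<rho> * n 0) * laplace (indicator {0..}) (s - 1)"
    by (simp add: laplace_def)
  ultimately show ?thesis using s by (simp add: laplace_indicator)
qed

definition G :: "complex \<Rightarrow> complex" where
  "G s = exp (- (s * of_real (ln (n 0)))) * (s * L s + of_real (\<rho> * n 0) * s / (s - 1))"

lemma L_holomorphic: "L holomorphic_on {s. Re s > \<beta>}"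
  using A_minus_B_bdd laplace_holomorphic unfolding L_def by blast

lemma G_holomorphic: "G holomorphic_on ({s. Re s > \<beta>} - {1})"
  unfolding G_def by (intro holomorphic_intros holomorphic_on_subset[OF L_holomorphic]) auto

lemma G_eq_dirichlet_sum: "Re s > 1 \<Longrightarrow> G s = dirichlet_sum a n s"
  by (simp add: dirichlet_sum_eq laplace_A_eq G_def algebra_simps)

text \<open>The explicit \<open>G\<close> has the defining property, so the choice operator really
  selects a continuation; the identity theorem then applies because a half-plane minus one point is
  still connected.\<close>

lemma dirichlet_cont_eq:
  assumes "Re s > \<beta>" "s \<noteq> 1"
  shows "dirichlet_cont a n \<beta> s = G s"
proof -
  define D where "D = {s. Re s > \<beta>} - {1}"
  define P where "P = (\<lambda>F. F holomorphic_on D \<and> (\<forall>s. Re s > 1 \<longrightarrow> F s = dirichlet_sum a n s))"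
  have "P G" using G_holomorphic G_eq_dirichlet_sum by (auto simp: P_def D_def)
  then have "P (SOME F. P F)" by (rule someI[of P])
  moreover have "dirichlet_cont a n \<beta> = (SOME F. P F)" by (simp only: dirichlet_cont_def P_def D_def)
  ultimately have "P (dirichlet_cont a n \<beta>)" by (simp only:)
  show ?thesis
  proof (rule analytic_continuation_open[where s = "{s. Re s > 1}" and s' = D and f = "dirichlet_cont a n \<beta>" and g = G])
    show "open {s. Re s > 1}" by (rule open_halfspace_Re_gt)
    show "open D" unfolding D_def by (intro open_delete open_halfspace_Re_gt)
    show "connected D" unfolding D_def
      by (intro connected_open_delete open_halfspace_Re_gt convex_connected convex_halfspace_Re_gt) simp
    have "2 \<in> {s. Re s > 1}" by simp
    then show "{s. Re s > 1} \<noteq> {}" by blast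
    show "{s. Re s > 1} \<subseteq> D" using \<beta> by (auto simp: D_def)
    show "s \<in> D" using assms by (auto simp: D_def)
  qed (use \<open>P G\<close> \<open>P (dirichlet_cont a n \<beta>)\<close> in \<open>auto simp: P_def\<close>)
qed

lemma dirichlet_cont_holomorphic: "dirichlet_cont a n \<beta> holomorphic_on ({s. Re s > \<beta>} - {1})"
  using G_holomorphic by (rule holomorphic_transform) (simp add: dirichlet_cont_eq)

section \<open>Size of the continued function and finiteness of its zeros\<close>

lemma dirichlet_cont_lower_bound:
  obtains c0 where "c0 > 1"
    "\<And>s. Re s \<ge> c0 \<Longrightarrow> norm (dirichlet_cont a n \<beta> s) \<ge> exp (- (Re s * ln (n 0))) * (a 0 / 2)"
proof -
  define b where "b = (\<lambda>x j. a j * exp (- (x * lam j)))"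
  have sm: "summable (\<lambda>j. of_real (a j) * exp (- (s * of_real (lam j))) :: complex)" if "Re s > 1" for s
    using exp_series_sums[OF that] by (rule sums_summable)
  have norm_b: "norm (of_real (a j) * exp (- (s * of_real (lam j))) :: complex) = b (Re s) j" for s j
    using a_pos[of j] by (simp add: norm_mult b_def)
  have smb: "summable (b x)" if "x > 1" for x
  proof -
    have "summable (\<lambda>j. Re (of_real (a j) * exp (- (of_real x * of_real (lam j)))))"
      by (rule summable_Re[OF sm]) (use that in simp)
    then show ?thesis by (simp add: b_def Re_exp)
  qed
  \<comment> \<open>Abscissa \<open>2\<close> is a reference point: passing from \<open>2\<close> to
    \<open>x\<close> multiplies every term after the first by at most
    \<open>exp (- ((x - 2) * lam (Suc 0)))\<close>, so far to the right the first term
    dominates.\<close>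
  define S2 where "S2 = (\<Sum>j. b 2 (Suc j))"
  have smS: "summable (\<lambda>j. b x (Suc j))" if "x > 1" for x
    using smb[OF that] by (subst summable_Suc_iff)
  have "((\<lambda>x. exp (- ((x - 2) * l))) \<longlongrightarrow> 0) at_top" if "l > 0" for l :: real
    using that by real_asymp
  from this[OF lam_1_pos] have "((\<lambda>x. exp (- ((x - 2) * lam (Suc 0))) * S2) \<longlongrightarrow> 0) at_top"
    by (rule tendsto_mult_left_zero)
  then have "\<forall>\<^sub>F x in at_top. exp (- ((x - 2) * lam (Suc 0))) * S2 < a 0 / 2"
    by (rule order_tendstoD(2)) (use a_pos[of 0] in simp)
  then obtain c1 where c1: "\<And>x. x \<ge> c1 \<Longrightarrow> exp (- ((x - 2) * lam (Suc 0))) * S2 < a 0 / 2"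
    by (auto simp: eventually_at_top_linorder)
  show ?thesis
  proof (rule that[of "max 2 c1"])
    fix s assume s: "Re s \<ge> max 2 c1"
    define x where "x = Re s"
    have x: "x \<ge> 2" "x \<ge> c1" "Re s > 1" using s by (auto simp: x_def)
    define h where "h = (\<lambda>j. of_real (a j) * exp (- (s * of_real (lam j))) :: complex)"
    have smh: "summable h" unfolding h_def by (rule sm) (use x in simp)
    have "norm (suminf h - h 0) = norm (\<Sum>j. h (Suc j))"
      using suminf_split_head[OF smh] by simp
    also have "\<dots> \<le> (\<Sum>j. norm (h (Suc j)))"
      by (rule summable_norm) (use smS[of x] x in \<open>simp add: h_def norm_b x_def\<close>)
    also have "\<dots> = (\<Sum>j. b x (Suc j))" by (simp only: h_def norm_b x_def)
    also have "\<dots> \<le> (\<Sum>j. exp (- ((x - 2) * lam (Suc 0))) * b 2 (Suc j))"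
    proof (rule suminf_le)
      fix j
      have "(x - 2) * lam (Suc 0) \<le> (x - 2) * lam (Suc j)"
        using x lam_mono[of "Suc 0" "Suc j"] by (intro mult_left_mono) auto
      then have "exp (- (x * lam (Suc j))) \<le> exp (- ((x - 2) * lam (Suc 0)) + - (2 * lam (Suc j)))"
        by (simp add: algebra_simps)
      then have "a (Suc j) * exp (- (x * lam (Suc j))) \<le> a (Suc j) * exp (- ((x - 2) * lam (Suc 0)) + - (2 * lam (Suc j)))"
        using a_pos[of "Suc j"] by (intro mult_left_mono) auto
      also have "\<dots> = exp (- ((x - 2) * lam (Suc 0))) * b 2 (Suc j)"
        unfolding exp_add b_def by (simp only: mult_ac)
      finally show "b x (Suc j) \<le> exp (- ((x - 2) * lam (Suc 0))) * b 2 (Suc j)" by (simp add: b_def)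
    qed (use smS x in \<open>auto intro!: summable_mult\<close>)
    also have "\<dots> = exp (- ((x - 2) * lam (Suc 0))) * S2"
      unfolding S2_def by (rule suminf_mult) (use smS in simp)
    also have "\<dots> < a 0 / 2" by (rule c1) (use x in simp)
    finally have "norm (suminf h - h 0) < a 0 / 2" .
    moreover have "norm (h 0) = a 0" using a_pos[of 0] by (simp add: h_def lam_0)
    ultimately have "norm (suminf h) \<ge> a 0 / 2"
      using norm_triangle_ineq2[of "h 0" "suminf h"] by (simp add: norm_minus_commute)
    moreover have "suminf h = s * laplace A s"
      unfolding h_def using exp_series_sums[OF x(3)] by (rule sums_unique[symmetric])
    ultimately have *: "norm (s * laplace A s) \<ge> a 0 / 2" by simp
    have "dirichlet_cont a n \<beta> s = exp (- (s * of_real (ln (n 0)))) * (s * laplace A s)"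
      using x \<beta> by (subst dirichlet_cont_eq) (auto simp: G_eq_dirichlet_sum dirichlet_sum_eq)
    then have "norm (dirichlet_cont a n \<beta> s) = exp (- (Re s * ln (n 0))) * norm (s * laplace A s)"
      by (simp add: norm_mult)
    then show "norm (dirichlet_cont a n \<beta> s) \<ge> exp (- (Re s * ln (n 0))) * (a 0 / 2)"
      using * by simp
  qed simp
qed

text \<open>Distance at least \<open>1\<close> from the pole keeps
  \<open>\<bar>w / (w - 1)\<bar>\<close> at most \<open>2\<close>, and the exponential bounds the
  modulus of \<open>n 0\<close> to the power \<open>- w\<close> for either sign of
  \<open>ln (n 0)\<close>.\<close>

lemma norm_dirichlet_cont_le:
  assumes "Re w > \<beta>" "norm (w - 1) \<ge> 1" "\<bar>Re w\<bar> \<le> b"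
  shows "norm (dirichlet_cont a n \<beta> w) \<le> exp (b * \<bar>ln (n 0)\<bar>) * (norm (w * L w) + 2 * \<rho> * n 0)"
proof -
  have "norm w \<le> 2 * norm (w - 1)" using norm_triangle_ineq2[of w 1] assms by simp
  then have q: "norm (w / (w - 1)) \<le> 2" using assms by (simp add: norm_divide divide_simps)
  have "- (Re w * ln (n 0)) \<le> \<bar>Re w\<bar> * \<bar>ln (n 0)\<bar>" by (metis abs_ge_minus_self abs_mult)
  also have "\<dots> \<le> b * \<bar>ln (n 0)\<bar>" using assms by (intro mult_right_mono) auto
  finally have e: "exp (- (Re w * ln (n 0))) \<le> exp (b * \<bar>ln (n 0)\<bar>)" by simp
  have "norm (w * L w + of_real (\<rho> * n 0) * w / (w - 1)) \<le> norm (w * L w) + norm (of_real (\<rho> * n 0) * w / (w - 1))"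
    by (rule norm_triangle_ineq)
  also have "norm (of_real (\<rho> * n 0) * w / (w - 1)) = \<rho> * n 0 * norm (w / (w - 1))"
    using \<rho> n_pos[of 0] by (simp add: norm_mult norm_divide)
  also have "\<dots> \<le> \<rho> * n 0 * 2" using q \<rho> n_pos[of 0] by (intro mult_left_mono) auto
  finally have "norm (w * L w + of_real (\<rho> * n 0) * w / (w - 1)) \<le> norm (w * L w) + 2 * \<rho> * n 0" by simp
  moreover have "w \<noteq> 1" using assms by auto
  ultimately show ?thesis
    using assms e by (simp add: dirichlet_cont_eq G_def norm_mult mult_mono)
qed

lemma finite_zeros_in:
  assumes "\<sigma> > \<beta>"
  shows "finite (zeros_in (dirichlet_cont a n \<beta>) \<sigma> T)"
proof -
  obtain c0 where c0: "c0 > 1"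
    "\<And>s. Re s \<ge> c0 \<Longrightarrow> norm (dirichlet_cont a n \<beta> s) \<ge> exp (- (Re s * ln (n 0))) * (a 0 / 2)"
    using dirichlet_cont_lower_bound by blast
  \<comment> \<open>Clearing the pole and dropping the nonvanishing exponential gives a function
    holomorphic also at \<open>1\<close>, so a compact rectangle containing \<open>1\<close> causes
    no trouble; its value \<open>\<rho> * n 0\<close> at \<open>1\<close> excludes the zero
    function.\<close>
  define H where "H = (\<lambda>s. s * (s - 1) * L s + of_real (\<rho> * n 0) * s)"
  define S where "S = {s. Re s > \<beta>}"
  define K where "K = cbox (Complex \<sigma> (- T)) (Complex c0 T)"
  have hH: "H holomorphic_on S"
    unfolding H_def S_def by (intro holomorphic_intros L_holomorphic)
  have sub: "zeros_in (dirichlet_cont a n \<beta>) \<sigma> T \<subseteq> {s\<in>K. H s = 0}"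
  proof
    fix s assume "s \<in> zeros_in (dirichlet_cont a n \<beta>) \<sigma> T"
    then have s: "s \<noteq> 1" "dirichlet_cont a n \<beta> s = 0" "Re s \<ge> \<sigma>" "\<bar>Im s\<bar> \<le> T"
      by (auto simp: zeros_in_def)
    have "Re s < c0"
    proof (rule ccontr)
      assume "\<not> Re s < c0"
      then have "exp (- (Re s * ln (n 0))) * (a 0 / 2) \<le> 0" using c0(2)[of s] s by simp
      then show False using a_pos[of 0] by (simp add: mult_le_0_iff)
    qed
    then have "s \<in> K" using s by (auto simp: K_def in_cbox_complex_iff)
    moreover have "s * L s + of_real (\<rho> * n 0) * s / (s - 1) = 0"
      using s assms by (simp add: dirichlet_cont_eq G_def)
    then have "H s = 0" using s by (simp add: H_def field_simps)
    ultimately show "s \<in> {s\<in>K. H s = 0}" by blast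
  qed
  have KS: "K \<subseteq> S" using assms by (auto simp: K_def S_def in_cbox_complex_iff)
  have "finite {s\<in>K. H s = 0}"
  proof (cases "H constant_on S")
    case True
    have "1 \<in> S" using \<beta> by (simp add: S_def)
    then have "H s = H 1" if "s \<in> S" for s using True that unfolding constant_on_def by metis
    moreover have "H 1 \<noteq> 0" using \<rho> n_pos[of 0] by (simp add: H_def)
    ultimately have "{s\<in>K. H s = 0} = {}" using KS by auto
    then show ?thesis by (simp only: finite.emptyI)
  next
    case False
    show ?thesis
      by (rule holomorphic_compact_finite_zeros[OF hH _ _ _ KS False])
         (auto simp: S_def K_def open_halfspace_Re_gt convex_connected convex_halfspace_Re_gt)
  qed
  then show ?thesis by (rule finite_subset[OF sub])
qed

section \<open>The count of zeros\<close>

lemma L_discrete_mean_square: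
  assumes "(1 + \<beta>) / 2 < \<sigma>"
  obtains C where "C > 0" "\<And>T M (w :: int \<Rightarrow> complex).
    \<lbrakk>T \<ge> 1; finite M;
     \<And>m. m \<in> M \<Longrightarrow> \<sigma> \<le> Re (w m) \<and> Re (w m) \<le> c \<and> \<bar>Im (w m) - m\<bar> \<le> R \<and> \<bar>Im (w m)\<bar> \<le> T\<rbrakk>
    \<Longrightarrow> (\<Sum>m\<in>M. (norm (w m * L (w m)))\<^sup>2) \<le> C * T"
proof -
  obtain K1 where K1: "exp_bdd 0 K1 1 A" "exp_bdd 0 K1 1 B" using A_B_bdd by blast
  obtain K where K: "exp_bdd 0 K \<beta> (\<lambda>u. A u - B u)" using A_minus_B_bdd by blast
  show ?thesis
    using laplace_discrete_mean_square[OF mono_A mono_B K1 K \<beta> assms, of c R] that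
    unfolding L_def by blast
qed

text \<open>
  The zeros are covered by discs of radius \<open>r\<close> around \<open>c + i*m\<close> with \<open>m\<close> an integer. Taking \<open>c\<close> large
  makes room for concentric discs of a larger radius \<open>R\<close> still inside \<open>Re s > (1 + \<beta>) / 2\<close>.
\<close>

lemma zero_count_bound:
  assumes \<sigma>: "(1 + \<beta>) / 2 < \<sigma>"
  shows "\<exists>C. \<forall>T\<ge>1. real (zero_count (dirichlet_cont a n \<beta>) \<sigma> T) \<le> C * T"
proof -
  define F where "F = dirichlet_cont a n \<beta>"
  define \<sigma>1 where "\<sigma>1 = ((1 + \<beta>) / 2 + \<sigma>) / 2"
  have \<sigma>1: "(1 + \<beta>) / 2 < \<sigma>1" "\<sigma>1 < \<sigma>" using \<sigma> by (auto simp: \<sigma>1_def field_simps)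
  have \<beta>\<sigma>1: "\<beta> < \<sigma>1" using \<sigma>1 \<beta> by (simp add: field_simps)
  obtain c0 where c0: "c0 > 1"
    "\<And>s. Re s \<ge> c0 \<Longrightarrow> norm (F s) \<ge> exp (- (Re s * ln (n 0))) * (a 0 / 2)"
    using dirichlet_cont_lower_bound unfolding F_def by blast
  \<comment> \<open>Three demands: the lower bound holds at the centres, the centres lie to the
    right of \<open>\<sigma>\<close>, and \<open>r < R\<close>. The last is met for large
    \<open>c\<close> since \<open>R^2 - (c - \<sigma>)^2 = (\<sigma> - \<sigma>1) * (2 * c -
    \<sigma> - \<sigma>1)\<close> grows with \<open>c\<close> and passes
    \<open>1 / 4\<close>.\<close>
  define c where "c = max (max c0 (\<sigma> + 1)) (1 / (\<sigma> - \<sigma>1) + \<sigma> + \<sigma>1)"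
  have c: "c \<ge> c0" "c \<ge> \<sigma> + 1" "c \<ge> 1 / (\<sigma> - \<sigma>1) + \<sigma> + \<sigma>1" by (auto simp: c_def)
  define R where "R = c - \<sigma>1"
  \<comment> \<open>The distance from a centre to the far corners of the rectangle
    \<open>\<sigma> \<le> Re s \<le> c\<close> of height \<open>1\<close>.\<close>
  define r where "r = sqrt ((c - \<sigma>)\<^sup>2 + (1 / 2)\<^sup>2)"
  have r: "0 < r" unfolding r_def by (intro real_sqrt_gt_zero add_nonneg_pos) auto
  have rR: "r < R"
  proof -
    have "1 / (\<sigma> - \<sigma>1) \<le> 2 * c - \<sigma> - \<sigma>1" using c c0 by linarith
    then have "1 \<le> (2 * c - \<sigma> - \<sigma>1) * (\<sigma> - \<sigma>1)" using \<sigma>1 by (simp add: pos_divide_le_eq)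
    then have "(c - \<sigma>)\<^sup>2 + (1 / 2)\<^sup>2 < R\<^sup>2" by (simp add: R_def power2_eq_square algebra_simps)
    moreover have "R > 0" using c \<sigma>1 by (simp add: R_def)
    ultimately show ?thesis unfolding r_def by (metis real_less_lsqrt less_imp_le)
  qed
  define \<mu> where "\<mu> = exp (- (c * ln (n 0))) * (a 0 / 2)"
  have \<mu>: "\<mu> > 0" using a_pos[of 0] by (simp add: \<mu>_def)
  define ctr where "ctr = (\<lambda>m :: int. Complex c (of_int m))"
  \<comment> \<open>Discs of radius at most \<open>c - \<beta>\<close> around centres of height at
    least \<open>M0\<close> in absolute value stay at distance at least \<open>1\<close> from the
    real axis, hence from the pole.\<close>
  define M0 where "M0 = c - \<beta> + 1"
  define \<kappa> where "\<kappa> = r / ((R - r) * \<mu>)"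
  have \<kappa>: "\<kappa> > 0" using r rR \<mu> by (simp add: \<kappa>_def)
  have disc: "Re w \<ge> \<sigma>1" "Re w \<le> 2 * c" "\<bar>Im w - m\<bar> \<le> R" "norm (w - 1) \<ge> 1" "\<bar>Im w\<bar> \<le> \<bar>of_int m\<bar> + R"
    if w: "dist (ctr m) w \<le> R" and m: "M0 \<le> \<bar>of_int m\<bar>" for w m
  proof -
    have 1: "\<bar>c - Re w\<bar> \<le> R" "\<bar>m - Im w\<bar> \<le> R"
      using abs_Re_le_cmod[of "ctr m - w"] abs_Im_le_cmod[of "ctr m - w"] w by (auto simp: dist_norm ctr_def)
    then show "Re w \<ge> \<sigma>1" "Re w \<le> 2 * c" "\<bar>Im w - m\<bar> \<le> R" "\<bar>Im w\<bar> \<le> \<bar>of_int m\<bar> + R"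
      using \<beta>\<sigma>1 \<beta> by (auto simp: R_def)
    have "\<bar>Im w\<bar> \<ge> 1" using 1 m \<beta>\<sigma>1 by (auto simp: M0_def R_def)
    then show "norm (w - 1) \<ge> 1" using abs_Im_le_cmod[of "w - 1"] by simp
  qed
  \<comment> \<open>By compactness the maximum on each circle is attained; such a point becomes the
    sample point \<open>w m\<close> of the mean square.\<close>
  have "\<exists>w. dist (ctr m) w = R \<and> (\<forall>z. dist (ctr m) z = R \<longrightarrow> norm (F z) \<le> norm (F w))"
    if m: "M0 \<le> \<bar>of_int m\<bar>" for m
  proof -
    have "continuous_on (sphere (ctr m) R) (\<lambda>z. norm (F z))"
    proof (rule continuous_on_norm, rule holomorphic_on_imp_continuous_on, rule holomorphic_on_subset)
      show "F holomorphic_on ({s. Re s > \<beta>} - {1})" unfolding F_def by (rule dirichlet_cont_holomorphic)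
      show "sphere (ctr m) R \<subseteq> {s. Re s > \<beta>} - {1}"
      proof
        fix w assume "w \<in> sphere (ctr m) R"
        then have "dist (ctr m) w \<le> R" by simp
        from disc(1,4)[OF this m] show "w \<in> {s. Re s > \<beta>} - {1}" using \<beta>\<sigma>1 by auto
      qed
    qed
    moreover have "sphere (ctr m) R \<noteq> {}" using r rR by simp
    ultimately obtain w where "w \<in> sphere (ctr m) R" "\<forall>z\<in>sphere (ctr m) R. norm (F z) \<le> norm (F w)"
      using continuous_attains_sup[of "sphere (ctr m) R" "\<lambda>z. norm (F z)"] by auto
    then show ?thesis by auto
  qed
  then obtain w where w: "\<And>m. M0 \<le> \<bar>of_int m\<bar> \<Longrightarrow> dist (ctr m) (w m) = R"
    "\<And>m z. M0 \<le> \<bar>of_int m\<bar> \<Longrightarrow> dist (ctr m) z = R \<Longrightarrow> norm (F z) \<le> norm (F (w m))"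
    by metis
  define C3 where "C3 = exp (2 * c * \<bar>ln (n 0)\<bar>)"
  have cluster: "real (\<Sum>z\<in>Z. nat (zorder F z)) \<le> \<kappa> * (C3 * ((norm (w m * L (w m)))\<^sup>2 + (1 + 2 * \<rho> * n 0)))"
    if m: "M0 \<le> \<bar>of_int m\<bar>" and Z: "finite Z" "\<And>z. z \<in> Z \<Longrightarrow> dist (ctr m) z \<le> r" for m Z
  proof -
    define S where "S = ball (ctr m) (c - \<beta>)"
    have "S \<subseteq> {s. Re s > \<beta>} - {1}"
    proof
      fix s assume "s \<in> S"
      then have "\<bar>c - Re s\<bar> < c - \<beta>" "\<bar>m - Im s\<bar> < c - \<beta>"
        using abs_Re_le_cmod[of "ctr m - s"] abs_Im_le_cmod[of "ctr m - s"] by (auto simp: S_def dist_norm ctr_def)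
      then have "Re s > \<beta>" "Im s \<noteq> 0" using m by (auto simp: M0_def)
      then show "s \<in> {s. Re s > \<beta>} - {1}" by auto
    qed
    then have hol: "F holomorphic_on S"
      unfolding F_def by (rule holomorphic_on_subset[OF dirichlet_cont_holomorphic])
    have "\<mu> \<le> norm (F (ctr m))" using c0(2)[of "ctr m"] c by (simp add: \<mu>_def ctr_def)
    then have "real (\<Sum>z\<in>Z. nat (zorder F z)) \<le> norm (F (w m)) * (r / ((R - r) * \<mu>))"
      using w(2)[OF m] \<mu> r rR Z \<beta>\<sigma>1
      by (intro jensen_zero_count_le[OF hol]) (auto simp: S_def R_def)
    then have 1: "real (\<Sum>z\<in>Z. nat (zorder F z)) \<le> \<kappa> * norm (F (w m))" by (simp add: \<kappa>_def mult.commute)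
    have wR: "dist (ctr m) (w m) \<le> R" using w(1)[OF m] by simp
    note d = disc[OF wR m]
    have 2: "norm (F (w m)) \<le> C3 * (norm (w m * L (w m)) + 2 * \<rho> * n 0)"
      unfolding F_def C3_def using d \<beta>\<sigma>1 \<beta> by (intro norm_dirichlet_cont_le) auto
    \<comment> \<open>Passage from the first power to the square by \<open>x \<le> x^2 + 1\<close>;
      the \<open>1\<close> is paid once per disc.\<close>
    have "0 \<le> (norm (w m * L (w m)) - 1)\<^sup>2" by simp
    then have "2 * norm (w m * L (w m)) \<le> (norm (w m * L (w m)))\<^sup>2 + 1" by (simp only: power2_diff) simp
    then have "norm (w m * L (w m)) + 2 * \<rho> * n 0 \<le> (norm (w m * L (w m)))\<^sup>2 + (1 + 2 * \<rho> * n 0)"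
      using norm_ge_zero[of "w m * L (w m)"] by linarith
    then have "C3 * (norm (w m * L (w m)) + 2 * \<rho> * n 0) \<le> C3 * ((norm (w m * L (w m)))\<^sup>2 + (1 + 2 * \<rho> * n 0))"
      by (intro mult_left_mono) (auto simp: C3_def)
    with 2 have "norm (F (w m)) \<le> C3 * ((norm (w m * L (w m)))\<^sup>2 + (1 + 2 * \<rho> * n 0))" by linarith
    then have "\<kappa> * norm (F (w m)) \<le> \<kappa> * (C3 * ((norm (w m * L (w m)))\<^sup>2 + (1 + 2 * \<rho> * n 0)))"
      using \<kappa> by (intro mult_left_mono) auto
    with 1 show ?thesis by linarith
  qed
  obtain C4 where C4: "C4 > 0" "\<And>T M (w :: int \<Rightarrow> complex).
    \<lbrakk>T \<ge> 1; finite M;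
     \<And>m. m \<in> M \<Longrightarrow> \<sigma>1 \<le> Re (w m) \<and> Re (w m) \<le> 2 * c \<and> \<bar>Im (w m) - m\<bar> \<le> R \<and> \<bar>Im (w m)\<bar> \<le> T\<rbrakk>
    \<Longrightarrow> (\<Sum>m\<in>M. (norm (w m * L (w m)))\<^sup>2) \<le> C4 * T"
    using L_discrete_mean_square[OF \<sigma>1(1), of "2 * c" R] by blast
  have fin: "finite (zeros_in F \<sigma> T)" for T
    unfolding F_def using \<beta>\<sigma>1 \<sigma>1 by (intro finite_zeros_in) simp
  \<comment> \<open>Zeros of small height, whose discs might reach the pole, are set apart; their
    number does not depend on \<open>T\<close>.\<close>
  define K0 where "K0 = real (zero_count F \<sigma> (M0 + 1))"
  \<comment> \<open>\<open>2 + R\<close>: the sample points have height at most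
    \<open>T + 1 + R \<le> (2 + R) * T\<close>. \<open>5\<close>: at most \<open>5 * T\<close>
    centres occur.\<close>
  define C where "C = K0 + \<kappa> * (C3 * (C4 * (2 + R) + 5 * (1 + 2 * \<rho> * n 0)))"
  have "real (zero_count F \<sigma> T) \<le> C * T" if T: "T \<ge> 1" for T
  proof -
    define I where "I = {m :: int. M0 \<le> \<bar>of_int m\<bar> \<and> \<bar>of_int m\<bar> \<le> T + 1}"
    have I_sub: "I \<subseteq> {-\<lfloor>T + 1\<rfloor>..\<lfloor>T + 1\<rfloor>}" by (auto simp: I_def abs_le_iff le_floor_iff) linarith+
    then have finI: "finite I" by (rule finite_subset) simp
    have "card I \<le> card {-\<lfloor>T + 1\<rfloor>..\<lfloor>T + 1\<rfloor>}" by (rule card_mono[OF _ I_sub]) simp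
    also have "\<dots> = nat (2 * \<lfloor>T + 1\<rfloor> + 1)" by simp
    finally have "real (card I) \<le> of_int (2 * \<lfloor>T + 1\<rfloor> + 1)" using T by linarith
    also have "\<dots> \<le> 2 * (T + 1) + 1" using of_int_floor_le[of "T + 1"] by simp
    also have "\<dots> \<le> 5 * T" using T by simp
    finally have cardI: "real (card I) \<le> 5 * T" .
    define g where "g = (\<lambda>z. nat (zorder F z))"
    define Z0 where "Z0 = {z \<in> zeros_in F \<sigma> T. \<bar>Im z\<bar> \<le> M0 + 1}"
    define Z1 where "Z1 = {z \<in> zeros_in F \<sigma> T. \<not> \<bar>Im z\<bar> \<le> M0 + 1}"
    \<comment> \<open>Each zero goes to the nearest integer height. Rounding moves the height by at
      most \<open>1 / 2\<close>, so the margins in \<open>M0 + 1\<close> and \<open>T + 1\<close>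
      keep the index in \<open>I\<close>.\<close>
    define Z where "Z = (\<lambda>m. {z \<in> Z1. round (Im z) = m})"
    have finZ: "finite Z0" "finite Z1" using fin[of T] by (auto simp: Z0_def Z1_def)
    have round: "\<bar>Im z - of_int (round (Im z))\<bar> \<le> 1 / 2" for z
      using of_int_round_abs_le[of "Im z"] by (simp add: abs_minus_commute)
    have "zero_count F \<sigma> T = sum g Z0 + sum g Z1"
      unfolding zero_count_def g_def[symmetric] using fin[of T]
      by (subst sum.union_disjoint[symmetric]) (auto simp: Z0_def Z1_def intro!: sum.cong)
    also have "sum g Z0 \<le> zero_count F \<sigma> (M0 + 1)"
      unfolding zero_count_def g_def[symmetric] using fin by (intro sum_mono2) (auto simp: Z0_def zeros_in_def)
    finally have "real (zero_count F \<sigma> T) \<le> K0 + real (sum g Z1)"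
      by (simp only: K0_def of_nat_add[symmetric] of_nat_le_iff)
    also have "sum g Z1 = (\<Sum>m\<in>I. sum g (Z m))"
      unfolding Z_def
    proof (rule sum.group[symmetric, OF finZ(2) finI], safe)
      fix z assume "z \<in> Z1"
      then have "\<bar>Im z\<bar> \<le> T" "\<not> \<bar>Im z\<bar> \<le> M0 + 1" by (auto simp: Z1_def zeros_in_def)
      then have "M0 \<le> \<bar>of_int (round (Im z))\<bar>" "\<bar>of_int (round (Im z))\<bar> \<le> T + 1"
        using round[of z] by linarith+
      then show "round (Im z) \<in> I" by (simp add: I_def)
    qed
    also have "real (\<Sum>m\<in>I. sum g (Z m)) = (\<Sum>m\<in>I. real (sum g (Z m)))" by simp
    also have "\<dots> \<le> (\<Sum>m\<in>I. \<kappa> * (C3 * ((norm (w m * L (w m)))\<^sup>2 + (1 + 2 * \<rho> * n 0))))"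
    proof (rule sum_mono)
      fix m assume m: "m \<in> I"
      have "dist (ctr m) z \<le> r" if "z \<in> Z m" for z
      proof -
        have z: "z \<in> zeros_in F \<sigma> T" "round (Im z) = m" using that by (auto simp: Z_def Z1_def)
        then have "Re z \<ge> \<sigma>" "F z = 0" by (auto simp: zeros_in_def)
        moreover have "Re z < c"
        proof (rule ccontr)
          assume "\<not> Re z < c"
          then have "exp (- (Re z * ln (n 0))) * (a 0 / 2) \<le> 0"
            using c0(2)[of z] c \<open>F z = 0\<close> by simp
          then show False using a_pos[of 0] by (simp add: mult_le_0_iff)
        qed
        ultimately have "\<bar>c - Re z\<bar> \<le> \<bar>c - \<sigma>\<bar>" by simp
        then have "(c - Re z)\<^sup>2 \<le> (c - \<sigma>)\<^sup>2" by (simp only: abs_le_square_iff)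
        moreover have "\<bar>m - Im z\<bar> \<le> \<bar>1 / 2\<bar>" using round[of z] z by (simp add: abs_minus_commute)
        then have "(m - Im z)\<^sup>2 \<le> (1 / 2)\<^sup>2" by (simp only: abs_le_square_iff)
        ultimately show ?thesis
          by (simp add: dist_norm cmod_def ctr_def r_def)
      qed
      then show "real (sum g (Z m)) \<le> \<kappa> * (C3 * ((norm (w m * L (w m)))\<^sup>2 + (1 + 2 * \<rho> * n 0)))"
        unfolding g_def using m finZ by (intro cluster) (auto simp: I_def Z_def)
    qed
    also have "\<dots> = \<kappa> * (C3 * ((\<Sum>m\<in>I. (norm (w m * L (w m)))\<^sup>2) + real (card I) * (1 + 2 * \<rho> * n 0)))"
      by (simp add: sum_distrib_left[symmetric] sum.distrib)
    also have "\<dots> \<le> \<kappa> * (C3 * (C4 * ((2 + R) * T) + (5 * T) * (1 + 2 * \<rho> * n 0)))"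
    proof (intro mult_left_mono add_mono mult_right_mono cardI)
      have R: "R > 0" using r rR by simp
      then have RT: "R * 1 \<le> R * T" using T by (intro mult_left_mono) auto
      show "(\<Sum>m\<in>I. (norm (w m * L (w m)))\<^sup>2) \<le> C4 * ((2 + R) * T)"
      proof (rule C4(2))
        show "1 \<le> (2 + R) * T" using RT T R unfolding ring_distribs by linarith
        fix m assume "m \<in> I"
        then have m: "M0 \<le> \<bar>of_int m\<bar>" "\<bar>of_int m\<bar> \<le> T + 1" by (auto simp: I_def)
        have "dist (ctr m) (w m) \<le> R" using w(1)[OF m(1)] by simp
        note d = disc[OF this m(1)]
        have "\<bar>Im (w m)\<bar> \<le> (2 + R) * T" using d(5) m(2) RT T unfolding ring_distribs by linarith
        then show "\<sigma>1 \<le> Re (w m) \<and> Re (w m) \<le> 2 * c \<and> \<bar>Im (w m) - m\<bar> \<le> R \<and> \<bar>Im (w m)\<bar> \<le> (2 + R) * T"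
          using d by simp
      qed (rule finI)
    qed (use \<kappa> \<rho> n_pos[of 0] in \<open>auto simp: C3_def\<close>)
    also have "K0 + \<kappa> * (C3 * (C4 * ((2 + R) * T) + (5 * T) * (1 + 2 * \<rho> * n 0))) \<le> C * T"
    proof -
      have "K0 * 1 \<le> K0 * T" using T by (intro mult_left_mono) (auto simp: K0_def)
      then show ?thesis by (simp add: C_def algebra_simps)
    qed
    finally show ?thesis by simp
  qed
  then show ?thesis unfolding F_def by blast
qed

end

theorem theorem5p1:
  fixes n a :: "nat \<Rightarrow> real" and \<rho> \<beta> \<sigma> :: real
  assumes "strict_mono n" and "\<not> bdd_above (range n)" and "\<And>j. n j > 0"
    and "\<And>j. a j > 0"
    and "\<rho> > 0" and "0 \<le> \<beta>" and "\<beta> < 1"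
    and "(\<lambda>x. summatory a n x - \<rho> * x) \<in> O[at_top](\<lambda>x. x powr \<beta>)"
    and "\<sigma> > (1 + \<beta>) / 2"
  shows "(\<forall>T>0. finite (zeros_in (dirichlet_cont a n \<beta>) \<sigma> T)) \<and>
    (\<exists>C::real. \<forall>\<^sub>F T in at_top. real (zero_count (dirichlet_cont a n \<beta>) \<sigma> T) \<le> C * T)"
proof -
  interpret regular_dirichlet_series n a \<rho> \<beta>
    by unfold_locales (use assms in auto)
  have "\<sigma> > \<beta>" using assms by (simp add: field_simps)
  then show ?thesis
    using finite_zeros_in zero_count_bound[OF assms(9)]
    by (auto simp: eventually_at_top_linorder)
qed

end
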